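(* Let $L'$ be a bounded lattice, let $L$ be a bounded lattice that can be obtained through finite direct products and/or finite ordinal sums from bounded distributive lattices and/or finite modular lattices and/or relatively complemented bounded lattices with the ascending chain condition, and let $m:L\to L'$ be a bounded lattice morphism. Then: (1) if $m$ is admissible, then $m$ fulfills GU; (2) if $L'$ is distributive, then $m$ is admissible and fulfills GU; (3) if $m(L)=\{0,1\}$, then $m$ is admissible and fulfills GU.
   Context: Bounded lattices are considered as algebras with operations $\vee,\wedge,0,1$; bounded lattice morphisms preserve these. The ordinal sum $L_1\oplus L_2$ of two bounded lattices is obtained by placing $L_2$ on top of $L_1$ and identifying the greatest element of $L_1$ with the least element of $L_2$. For a bounded lattice $M$, $\mathrm{Con}(M)$ is its congruence lattice and $\nabla_M=M^2$. Since the variety of bounded lattices is congruence-distributive, the commutator of congruences is the intersection, so a congruence $\phi\neq\nabla_M$ is prime if, for all $\alpha,\beta\in\mathrm{Con}(M)$, $\alpha\cap\beta\subseteq\phi$ implies $\alpha\subseteq\phi$ or $\beta\subseteq\phi$; $\mathrm{Spec}(M)$ is the set of prime congruences of $M$. For a morphism $f:A\to B$ and $\psi\in\mathrm{Con}(B)$, $f^*(\psi)=\{(x,y)\in A^2 : (f(x),f(y))\in\psi\}\in\mathrm{Con}(A)$. $f$ is admissible if $f^*(\psi)\in\mathrm{Spec}(A)$ for all $\psi\in\mathrm{Spec}(B)$. An admissible morphism $f:A\to B$ fulfills GU (Going Up) if for all $\phi,\psi\in\mathrm{Spec}(A)$ and $\phi_1\in\mathrm{Spec}(B)$ with $\phi\subseteq\psi$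 and $f^*(\phi_1)=\phi$ there is $\psi_1\in\mathrm{Spec}(B)$ with $\phi_1\subseteq\psi_1$ and $f^*(\psi_1)=\psi$. *)

theory Defs
  imports "HOL-Algebra.Lattice"
begin

section \<open>Bounded lattices and their morphisms\<close>

definition bl_hom :: "'a gorder \<Rightarrow> 'b gorder \<Rightarrow> ('a \<Rightarrow> 'b) set" where
  "bl_hom A B = {f \<in> carrier A \<rightarrow> carrier B.
     join_pres A B f \<and> meet_pres A B f \<and> f \<bottom>\<^bsub>A\<^esub> = \<bottom>\<^bsub>B\<^esub> \<and> f \<top>\<^bsub>A\<^esub> = \<top>\<^bsub>B\<^esub>}"

definition bl_isomorphic :: "'a gorder \<Rightarrow> 'b gorder \<Rightarrow> bool" where
  "bl_isomorphic A B \<longleftrightarrow> (\<exists>f \<in> bl_hom A B. bij_betw f (carrier A) (carrier B))"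

definition distributive_lattice :: "'a gorder \<Rightarrow> bool" where
  "distributive_lattice L \<longleftrightarrow> lattice L \<and>
     (\<forall>x \<in> carrier L. \<forall>y \<in> carrier L. \<forall>z \<in> carrier L.
        x \<sqinter>\<^bsub>L\<^esub> (y \<squnion>\<^bsub>L\<^esub> z) = (x \<sqinter>\<^bsub>L\<^esub> y) \<squnion>\<^bsub>L\<^esub> (x \<sqinter>\<^bsub>L\<^esub> z))"

definition modular_lattice :: "'a gorder \<Rightarrow> bool" where
  "modular_lattice L \<longleftrightarrow> lattice L \<and>
     (\<forall>x \<in> carrier L. \<forall>y \<in> carrier L. \<forall>z \<in> carrier L.
        x \<sqsubseteq>\<^bsub>L\<^esub> z \<longrightarrow> x \<squnion>\<^bsub>L\<^esub> (y \<sqinter>\<^bsub>L\<^esub> z) = (x \<squnion>\<^bsub>L\<^esub> y) \<sqinter>\<^bsub>L\<^esub> z)"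

definition relatively_complemented_lattice :: "'a gorder \<Rightarrow> bool" where
  "relatively_complemented_lattice L \<longleftrightarrow> lattice L \<and>
     (\<forall>a \<in> carrier L. \<forall>b \<in> carrier L. \<forall>x \<in> carrier L.
        a \<sqsubseteq>\<^bsub>L\<^esub> x \<and> x \<sqsubseteq>\<^bsub>L\<^esub> b \<longrightarrow>
        (\<exists>y \<in> carrier L. a \<sqsubseteq>\<^bsub>L\<^esub> y \<and> y \<sqsubseteq>\<^bsub>L\<^esub> b \<and> x \<sqinter>\<^bsub>L\<^esub> y = a \<and> x \<squnion>\<^bsub>L\<^esub> y = b))"

definition ascending_chain_condition :: "'a gorder \<Rightarrow> bool" where
  "ascending_chain_condition L \<longleftrightarrow>
     \<not> (\<exists>c :: nat \<Rightarrow> 'a. \<forall>n. c n \<in> carrier L \<and> c n \<sqsubset>\<^bsub>L\<^esub> c (Suc n))"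


section \<open>Direct products and ordinal sums\<close>

definition lattice_product :: "'i set \<Rightarrow> ('i \<Rightarrow> 'a gorder) \<Rightarrow> ('i \<Rightarrow> 'a) gorder" where
  "lattice_product I M =
     \<lparr> carrier = (\<Pi>\<^sub>E i \<in> I. carrier (M i)),
       eq = (=),
       le = (\<lambda>x y. \<forall>i \<in> I. x i \<sqsubseteq>\<^bsub>M i\<^esub> y i) \<rparr>"

text \<open>
  The identified element (greatest in \<open>A\<close>, least in \<open>B\<close>) is represented by \<open>Inl \<top>\<^bsub>A\<^esub>\<close>;
  the copy of \<open>\<bottom>\<^bsub>B\<^esub>\<close> is left out of the carrier.
\<close>

definition ordinal_sum :: "'a gorder \<Rightarrow> 'b gorder \<Rightarrow> ('a + 'b) gorder" where
  "ordinal_sum A B =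
     \<lparr> carrier = Inl ` carrier A \<union> Inr ` (carrier B - {\<bottom>\<^bsub>B\<^esub>}),
       eq = (=),
       le = (\<lambda>x y. case (x, y) of
               (Inl a, Inl a') \<Rightarrow> a \<sqsubseteq>\<^bsub>A\<^esub> a'
             | (Inl a, Inr b') \<Rightarrow> True
             | (Inr b, Inl a') \<Rightarrow> False
             | (Inr b, Inr b') \<Rightarrow> b \<sqsubseteq>\<^bsub>B\<^esub> b') \<rparr>"

text \<open>
  All lattices of a construction are taken on subsets of one type \<open>'a\<close>, and the product or ordinal
  sum is carried back to \<open>'a\<close> along an isomorphism. This excludes no construction of a lattice on
  \<open>'a\<close>: every factor of a product and every summand of an ordinal sum injects into the result, so
  its carrier has a copy inside \<open>'a\<close>.
\<close>

inductive constructible :: "'a gorder \<Rightarrow> bool" where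
  distributive:
    "\<lbrakk>bounded_lattice L; distributive_lattice L\<rbrakk> \<Longrightarrow> constructible L"
| finite_modular:
    "\<lbrakk>bounded_lattice L; modular_lattice L; finite (carrier L)\<rbrakk> \<Longrightarrow> constructible L"
| relatively_complemented:
    "\<lbrakk>bounded_lattice L; relatively_complemented_lattice L; ascending_chain_condition L\<rbrakk>
     \<Longrightarrow> constructible L"
| product:
    "\<lbrakk>\<And>i. i < n \<Longrightarrow> constructible (M i);
      bounded_lattice L; bl_isomorphic (lattice_product {..<n::nat} M) L\<rbrakk>
     \<Longrightarrow> constructible L"
| ordinal_sum:
    "\<lbrakk>constructible A; constructible B;
      bounded_lattice L; bl_isomorphic (ordinal_sum A B) L\<rbrakk>
     \<Longrightarrow> constructible L"


section \<open>Congruences, prime congruences, admissibility and Going Up\<close>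

definition Con :: "'a gorder \<Rightarrow> ('a \<times> 'a) set set" where
  "Con M = {\<theta>. equiv (carrier M) \<theta> \<and>
     (\<forall>x x' y y'. (x, x') \<in> \<theta> \<and> (y, y') \<in> \<theta> \<longrightarrow>
        (x \<squnion>\<^bsub>M\<^esub> y, x' \<squnion>\<^bsub>M\<^esub> y') \<in> \<theta> \<and> (x \<sqinter>\<^bsub>M\<^esub> y, x' \<sqinter>\<^bsub>M\<^esub> y') \<in> \<theta>)}"

definition Spec :: "'a gorder \<Rightarrow> ('a \<times> 'a) set set" where
  "Spec M = {\<phi> \<in> Con M. \<phi> \<noteq> carrier M \<times> carrier M \<and>
     (\<forall>\<alpha> \<in> Con M. \<forall>\<beta> \<in> Con M. \<alpha> \<inter> \<beta> \<subseteq> \<phi> \<longrightarrow> \<alpha> \<subseteq> \<phi> \<or> \<beta> \<subseteq> \<phi>)}"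

definition pullback :: "'a gorder \<Rightarrow> ('a \<Rightarrow> 'b) \<Rightarrow> ('b \<times> 'b) set \<Rightarrow> ('a \<times> 'a) set" where
  "pullback A f \<psi> = {(x, y). x \<in> carrier A \<and> y \<in> carrier A \<and> (f x, f y) \<in> \<psi>}"

definition admissible :: "'a gorder \<Rightarrow> 'b gorder \<Rightarrow> ('a \<Rightarrow> 'b) \<Rightarrow> bool" where
  "admissible A B f \<longleftrightarrow> (\<forall>\<psi> \<in> Spec B. pullback A f \<psi> \<in> Spec A)"

definition going_up :: "'a gorder \<Rightarrow> 'b gorder \<Rightarrow> ('a \<Rightarrow> 'b) \<Rightarrow> bool" where
  "going_up A B f \<longleftrightarrow>
     (\<forall>\<phi> \<in> Spec A. \<forall>\<psi> \<in> Spec A. \<forall>\<phi>\<^sub>1 \<in> Spec B.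
        \<phi> \<subseteq> \<psi> \<and> pullback A f \<phi>\<^sub>1 = \<phi> \<longrightarrow>
        (\<exists>\<psi>\<^sub>1 \<in> Spec B. \<phi>\<^sub>1 \<subseteq> \<psi>\<^sub>1 \<and> pullback A f \<psi>\<^sub>1 = \<psi>))"

end

theory Submission
  imports Defs
begin

text \<open>
  In \<open>L\<close> every prime congruence is maximal among the proper ones, so the inclusion \<open>\<phi> \<subseteq> \<psi>\<close> in GU is an
  equality and GU is trivial.

  For modular lattices and for relatively complemented lattices, the pairs \<open>(x, y)\<close> such that \<open>\<theta>\<close>
  identifies no two distinct comparable elements of the interval from \<open>x \<sqinter> y\<close> to \<open>x \<squnion> y\<close> form a congruence
  \<open>\<theta>*\<close> (weak modularity). It satisfies \<open>\<theta> \<inter> \<theta>* = \<Delta>\<close>, and with the ascending chain condition an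
  increasing chain starting at \<open>0\<close> shows that \<open>\<theta>\<close> and \<open>\<theta>*\<close> generate \<open>\<nabla>\<close>. Hence if \<open>\<phi>\<close> is prime and
  \<open>\<phi> \<subset> \<psi>\<close>, then \<open>\<psi>* \<subseteq> \<phi> \<subseteq> \<psi>\<close> and \<open>\<psi> = \<nabla>\<close>. In a distributive lattice a prime congruence has just
  the two classes of \<open>0\<close> and \<open>1\<close>, because \<open>x \<sqinter> a = y \<sqinter> a\<close> and \<open>x \<squnion> a = y \<squnion> a\<close> define congruences in \<open>x, y\<close>
  with trivial intersection. Direct products and ordinal sums are finite subdirect products of their
  constituents; a prime congruence contains the kernel of one of the projections and so comes from
  a constituent.

  Admissibility in (2) and (3) holds because a congruence with exactly the two classes of \<open>0\<close> and
  \<open>1\<close> is always prime.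
\<close>

section \<open>Lattices and congruences\<close>

locale gorder_lattice = lattice L for L :: "'a gorder" (structure)
begin

lemma join_eqI:
  assumes "x \<in> carrier L" "y \<in> carrier L" "z \<in> carrier L" "x \<sqsubseteq> z" "y \<sqsubseteq> z"
    and "\<And>w. w \<in> carrier L \<Longrightarrow> x \<sqsubseteq> w \<Longrightarrow> y \<sqsubseteq> w \<Longrightarrow> z \<sqsubseteq> w"
  shows "x \<squnion> y = z"
  using assms by (intro le_antisym join_le) (auto simp: join_left join_right)

lemma meet_eqI:
  assumes "x \<in> carrier L" "y \<in> carrier L" "z \<in> carrier L" "z \<sqsubseteq> x" "z \<sqsubseteq> y"
    and "\<And>w. w \<in> carrier L \<Longrightarrow> w \<sqsubseteq> x \<Longrightarrow> w \<sqsubseteq> y \<Longrightarrow> w \<sqsubseteq> z"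
  shows "x \<sqinter> y = z"
  using assms by (intro le_antisym meet_le) (auto simp: meet_left meet_right)

lemma join_absorb1: "\<lbrakk>y \<sqsubseteq> x; x \<in> carrier L; y \<in> carrier L\<rbrakk> \<Longrightarrow> x \<squnion> y = x"
  by (rule join_eqI) auto

lemma join_absorb2: "\<lbrakk>x \<sqsubseteq> y; x \<in> carrier L; y \<in> carrier L\<rbrakk> \<Longrightarrow> x \<squnion> y = y"
  by (rule join_eqI) auto

lemma meet_absorb1: "\<lbrakk>x \<sqsubseteq> y; x \<in> carrier L; y \<in> carrier L\<rbrakk> \<Longrightarrow> x \<sqinter> y = x"
  by (rule meet_eqI) auto

lemma meet_absorb2: "\<lbrakk>y \<sqsubseteq> x; x \<in> carrier L; y \<in> carrier L\<rbrakk> \<Longrightarrow> x \<sqinter> y = y"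
  by (rule meet_eqI) auto

lemma le_joinI1: "\<lbrakk>z \<sqsubseteq> x; x \<in> carrier L; y \<in> carrier L; z \<in> carrier L\<rbrakk> \<Longrightarrow> z \<sqsubseteq> x \<squnion> y"
  by (meson join_closed join_left le_trans)

lemma le_joinI2: "\<lbrakk>z \<sqsubseteq> y; x \<in> carrier L; y \<in> carrier L; z \<in> carrier L\<rbrakk> \<Longrightarrow> z \<sqsubseteq> x \<squnion> y"
  by (meson join_closed join_right le_trans)

lemma meet_leI1: "\<lbrakk>x \<sqsubseteq> z; x \<in> carrier L; y \<in> carrier L; z \<in> carrier L\<rbrakk> \<Longrightarrow> x \<sqinter> y \<sqsubseteq> z"
  by (meson meet_closed meet_left le_trans)

lemma meet_leI2: "\<lbrakk>y \<sqsubseteq> z; x \<in> carrier L; y \<in> carrier L; z \<in> carrier L\<rbrakk> \<Longrightarrow> x \<sqinter> y \<sqsubseteq> z"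
  by (meson meet_closed meet_right le_trans)

lemma join_le_iff:
  "\<lbrakk>x \<in> carrier L; y \<in> carrier L; z \<in> carrier L\<rbrakk> \<Longrightarrow> x \<squnion> y \<sqsubseteq> z \<longleftrightarrow> x \<sqsubseteq> z \<and> y \<sqsubseteq> z"
  by (meson join_closed join_le join_left join_right le_trans)

lemma le_meet_iff:
  "\<lbrakk>x \<in> carrier L; y \<in> carrier L; z \<in> carrier L\<rbrakk> \<Longrightarrow> z \<sqsubseteq> x \<sqinter> y \<longleftrightarrow> z \<sqsubseteq> x \<and> z \<sqsubseteq> y"
  by (meson meet_closed meet_le meet_left meet_right le_trans)

lemma meet_mono:
  "\<lbrakk>a \<sqsubseteq> c; b \<sqsubseteq> d; a \<in> carrier L; b \<in> carrier L; c \<in> carrier L; d \<in> carrier L\<rbrakk>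
    \<Longrightarrow> a \<sqinter> b \<sqsubseteq> c \<sqinter> d"
  by (simp add: meet_le meet_leI1 meet_leI2)

lemma join_assoc:
  "\<lbrakk>x \<in> carrier L; y \<in> carrier L; z \<in> carrier L\<rbrakk> \<Longrightarrow> (x \<squnion> y) \<squnion> z = x \<squnion> (y \<squnion> z)"
  using weak_join_assoc by (simp add: eq_is_equal)

lemma meet_assoc:
  "\<lbrakk>x \<in> carrier L; y \<in> carrier L; z \<in> carrier L\<rbrakk> \<Longrightarrow> (x \<sqinter> y) \<sqinter> z = x \<sqinter> (y \<sqinter> z)"
  using weak_meet_assoc by (simp add: eq_is_equal)

lemma meet_le_join: "\<lbrakk>x \<in> carrier L; y \<in> carrier L\<rbrakk> \<Longrightarrow> x \<sqinter> y \<sqsubseteq> x \<squnion> y"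
  by (simp add: le_joinI1 meet_left)

end

section \<open>Congruences and the interval criterion\<close>

lemma ConI:
  fixes L (structure)
  assumes "\<theta> \<subseteq> carrier L \<times> carrier L"
    and "\<And>x. x \<in> carrier L \<Longrightarrow> (x, x) \<in> \<theta>"
    and "\<And>x y. (x, y) \<in> \<theta> \<Longrightarrow> (y, x) \<in> \<theta>"
    and "\<And>x y z. (x, y) \<in> \<theta> \<Longrightarrow> (y, z) \<in> \<theta> \<Longrightarrow> (x, z) \<in> \<theta>"
    and "\<And>x x' y y'. (x, x') \<in> \<theta> \<Longrightarrow> (y, y') \<in> \<theta> \<Longrightarrow> (x \<squnion> y, x' \<squnion> y') \<in> \<theta>"
    and "\<And>x x' y y'. (x, x') \<in> \<theta> \<Longrightarrow> (y, y') \<in> \<theta> \<Longrightarrow> (x \<sqinter> y, x' \<sqinter> y') \<in> \<theta>"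
  shows "\<theta> \<in> Con L"
proof -
  have "equiv (carrier L) \<theta>"
    by (intro equivI refl_onI symI transI) (fact assms)+
  then show ?thesis
    unfolding Con_def by (simp add: assms(5,6))
qed

lemma
  fixes L (structure)
  assumes "\<theta> \<in> Con L"
  shows Con_carrier: "\<And>x y. (x, y) \<in> \<theta> \<Longrightarrow> x \<in> carrier L \<and> y \<in> carrier L"
    and Con_refl: "\<And>x. x \<in> carrier L \<Longrightarrow> (x, x) \<in> \<theta>"
    and Con_sym: "\<And>x y. (x, y) \<in> \<theta> \<Longrightarrow> (y, x) \<in> \<theta>"
    and Con_trans: "\<And>x y z. (x, y) \<in> \<theta> \<Longrightarrow> (y, z) \<in> \<theta> \<Longrightarrow> (x, z) \<in> \<theta>"
    and Con_join: "\<And>x x' y y'. (x, x') \<in> \<theta> \<Longrightarrow> (y, y') \<in> \<theta> \<Longrightarrow> (x \<squnion> y, x' \<squnion> y') \<in> \<theta>"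
    and Con_meet: "\<And>x x' y y'. (x, x') \<in> \<theta> \<Longrightarrow> (y, y') \<in> \<theta> \<Longrightarrow> (x \<sqinter> y, x' \<sqinter> y') \<in> \<theta>"
  using assms unfolding Con_def equiv_def by (auto dest: refl_onD symD transD)

lemma Con_subset: "\<theta> \<in> Con L \<Longrightarrow> \<theta> \<subseteq> carrier L \<times> carrier L"
  using Con_carrier by fast

lemma Con_Int:
  assumes "\<alpha> \<in> Con L" "\<beta> \<in> Con L"
  shows "\<alpha> \<inter> \<beta> \<in> Con L"
proof (rule ConI)
  fix x y z assume "(x, y) \<in> \<alpha> \<inter> \<beta>" "(y, z) \<in> \<alpha> \<inter> \<beta>"
  then show "(x, z) \<in> \<alpha> \<inter> \<beta>"
    using Con_trans[OF assms(1), of x y z] Con_trans[OF assms(2), of x y z] by simp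
qed (use assms in \<open>simp_all add: Con_refl Con_sym Con_join Con_meet Con_subset le_infI1\<close>)

text \<open>Meeting the pair of bounds with \<open>x\<close> puts every \<open>x\<close> into the
  class of the least element. Properness thus becomes a condition on a single pair.\<close>

lemma Con_eq_full:
  assumes "bounded_lattice L" "\<theta> \<in> Con L" "(\<bottom>\<^bsub>L\<^esub>, \<top>\<^bsub>L\<^esub>) \<in> \<theta>"
  shows "\<theta> = carrier L \<times> carrier L"
proof
  interpret bounded_lattice L by fact
  interpret gorder_lattice L ..
  have "(\<bottom>\<^bsub>L\<^esub>, x) \<in> \<theta>" if "x \<in> carrier L" for x
    using Con_meet[OF assms(2,3) Con_refl[OF assms(2) that]] that
    by (simp add: meet_absorb1 meet_absorb2)
  then show "carrier L \<times> carrier L \<subseteq> \<theta>"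
    by (auto intro: Con_trans[OF assms(2) Con_sym[OF assms(2)]])
qed (rule Con_subset[OF assms(2)])

context gorder_lattice
begin

text \<open>Graetzer's criterion, with \<open>R\<close> read as the set of collapsed intervals.\<close>
lemma Con_of_intervals:
  assumes refl: "\<And>x. x \<in> carrier L \<Longrightarrow> R x x"
    and sub: "\<And>x y a b. \<lbrakk>x \<in> carrier L; y \<in> carrier L; a \<in> carrier L; b \<in> carrier L;
        x \<sqsubseteq> a; a \<sqsubseteq> b; b \<sqsubseteq> y; R x y\<rbrakk> \<Longrightarrow> R a b"
    and trans: "\<And>x y z. \<lbrakk>x \<in> carrier L; y \<in> carrier L; z \<in> carrier L;
        x \<sqsubseteq> y; y \<sqsubseteq> z; R x y; R y z\<rbrakk> \<Longrightarrow> R x z"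
    and join: "\<And>x y t. \<lbrakk>x \<in> carrier L; y \<in> carrier L; t \<in> carrier L; x \<sqsubseteq> y; R x y\<rbrakk>
        \<Longrightarrow> R (x \<squnion> t) (y \<squnion> t)"
    and meet: "\<And>x y t. \<lbrakk>x \<in> carrier L; y \<in> carrier L; t \<in> carrier L; x \<sqsubseteq> y; R x y\<rbrakk>
        \<Longrightarrow> R (x \<sqinter> t) (y \<sqinter> t)"
  shows "{(x, y). x \<in> carrier L \<and> y \<in> carrier L \<and> R (x \<sqinter> y) (x \<squnion> y)} \<in> Con L"
    (is "?\<theta> \<in> _")
proof -
  \<comment> \<open>The interval \<open>?m\<close> to \<open>?j\<close> is assembled from three
    collapsed pieces, cut at \<open>x \<sqinter> y\<close> and \<open>x \<squnion> y\<close>; the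
    interval of \<open>x\<close> and \<open>z\<close> lies inside it.\<close>
  have tr: "(x, z) \<in> ?\<theta>" if "(x, y) \<in> ?\<theta>" "(y, z) \<in> ?\<theta>" for x y z
  proof -
    from that have c [simp]: "x \<in> carrier L" "y \<in> carrier L" "z \<in> carrier L"
      and xy: "R (x \<sqinter> y) (x \<squnion> y)" and yz: "R (y \<sqinter> z) (y \<squnion> z)" by auto
    let ?j = "x \<squnion> y \<squnion> z" and ?m = "x \<sqinter> y \<sqinter> z"
    \<comment> \<open>Joining with \<open>x \<squnion> y\<close> moves the interval of
      \<open>y\<close> and \<open>z\<close> to the upper outer piece; meeting with
      \<open>x \<sqinter> y\<close> below moves it to the lower one.\<close>
    have "R ((y \<sqinter> z) \<squnion> (x \<squnion> y)) ((y \<squnion> z) \<squnion> (x \<squnion> y))"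
      by (rule join) (simp_all add: yz meet_le_join)
    moreover have "(y \<sqinter> z) \<squnion> (x \<squnion> y) = x \<squnion> y"
      by (simp add: join_absorb2 meet_leI1 join_right)
    moreover have "(y \<squnion> z) \<squnion> (x \<squnion> y) = ?j"
      by (rule join_eqI) (simp_all add: join_le_iff le_joinI1 le_joinI2)
    ultimately have upper: "R (x \<squnion> y) ?j" by simp
    have "R ((y \<sqinter> z) \<sqinter> (x \<sqinter> y)) ((y \<squnion> z) \<sqinter> (x \<sqinter> y))"
      by (rule meet) (simp_all add: yz meet_le_join)
    moreover have "(y \<squnion> z) \<sqinter> (x \<sqinter> y) = x \<sqinter> y"
      by (simp add: meet_absorb2 le_joinI1 meet_right)
    moreover have "(y \<sqinter> z) \<sqinter> (x \<sqinter> y) = ?m"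
      by (rule meet_eqI) (simp_all add: le_meet_iff meet_leI1 meet_leI2)
    ultimately have lower: "R ?m (x \<sqinter> y)" by simp
    have "R ?m (x \<squnion> y)"
      by (rule trans[of _ "x \<sqinter> y"]) (simp_all add: lower xy meet_le_join meet_left)
    then have "R ?m ?j"
      by (rule trans[of _ "x \<squnion> y", rotated -2])
        (simp_all add: upper join_left meet_leI1 meet_le_join)
    then have "R (x \<sqinter> z) (x \<squnion> z)"
      by (rule sub[rotated -1])
        (simp_all add: meet_le_join le_meet_iff join_le_iff le_joinI1 le_joinI2 meet_leI1 meet_leI2)
    then show ?thesis by simp
  qed
  \<comment> \<open>Translation by one fixed element is enough: compatibility in both arguments is a
    composite of two translations, linked by \<open>tr\<close>.\<close>
  have jn: "(x \<squnion> t, y \<squnion> t) \<in> ?\<theta>" if "(x, y) \<in> ?\<theta>" "t \<in> carrier L" for x y t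
  proof -
    from that have c [simp]: "x \<in> carrier L" "y \<in> carrier L" "t \<in> carrier L"
      and xy: "R (x \<sqinter> y) (x \<squnion> y)" by auto
    have "R ((x \<sqinter> y) \<squnion> t) ((x \<squnion> y) \<squnion> t)"
      by (rule join) (simp_all add: xy meet_le_join)
    then have "R ((x \<squnion> t) \<sqinter> (y \<squnion> t)) ((x \<squnion> t) \<squnion> (y \<squnion> t))"
      by (rule sub[rotated -1])
        (simp_all add: meet_le_join le_meet_iff join_le_iff le_joinI1 le_joinI2 meet_leI1 meet_leI2)
    then show ?thesis by simp
  qed
  have mt: "(x \<sqinter> t, y \<sqinter> t) \<in> ?\<theta>" if "(x, y) \<in> ?\<theta>" "t \<in> carrier L" for x y t
  proof -
    from that have c [simp]: "x \<in> carrier L" "y \<in> carrier L" "t \<in> carrier L"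
      and xy: "R (x \<sqinter> y) (x \<squnion> y)" by auto
    have "R ((x \<sqinter> y) \<sqinter> t) ((x \<squnion> y) \<sqinter> t)"
      by (rule meet) (simp_all add: xy meet_le_join)
    then have "R ((x \<sqinter> t) \<sqinter> (y \<sqinter> t)) ((x \<sqinter> t) \<squnion> (y \<sqinter> t))"
      by (rule sub[rotated -1])
        (simp_all add: meet_le_join le_meet_iff join_le_iff le_joinI1 le_joinI2 meet_leI1 meet_leI2)
    then show ?thesis by simp
  qed
  show ?thesis
  proof (rule ConI)
    fix x x' y y' assume xy: "(x, x') \<in> ?\<theta>" "(y, y') \<in> ?\<theta>"
    then have c: "x \<in> carrier L" "x' \<in> carrier L" "y \<in> carrier L" "y' \<in> carrier L" by auto
    show "(x \<squnion> y, x' \<squnion> y') \<in> ?\<theta>"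
      using tr[OF jn[OF xy(1) c(3)] jn[OF xy(2) c(2), unfolded join_comm[of _ _ x']]] .
    show "(x \<sqinter> y, x' \<sqinter> y') \<in> ?\<theta>"
      using tr[OF mt[OF xy(1) c(3)] mt[OF xy(2) c(2), unfolded meet_comm[of _ _ x']]] .
  next
    fix x assume "x \<in> carrier L"
    then show "(x, x) \<in> ?\<theta>" by (simp add: refl join_absorb1 meet_absorb1)
  next
    fix x y z assume "(x, y) \<in> ?\<theta>" "(y, z) \<in> ?\<theta>"
    then show "(x, z) \<in> ?\<theta>" by (rule tr)
  next
    fix x y assume "(x, y) \<in> ?\<theta>"
    then show "(y, x) \<in> ?\<theta>" by (simp add: join_comm[of L x] meet_comm[of L x])
  qed (simp add: subset_iff)
qed

end

section \<open>Weak modularity and maximality of prime congruences\<close>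

text \<open>The restriction of a congruence \<open>\<theta>\<close> to the interval is the diagonal.
  Comparable pairs suffice, because a congruence that identifies two elements also identifies their
  meet and join.\<close>

definition separates_interval :: "'a gorder \<Rightarrow> ('a \<times> 'a) set \<Rightarrow> 'a \<Rightarrow> 'a \<Rightarrow> bool" where
  "separates_interval L \<theta> x y \<longleftrightarrow>
    (\<forall>u \<in> carrier L. \<forall>v \<in> carrier L.
      x \<sqsubseteq>\<^bsub>L\<^esub> u \<and> u \<sqsubseteq>\<^bsub>L\<^esub> v \<and> v \<sqsubseteq>\<^bsub>L\<^esub> y \<and> (u, v) \<in> \<theta> \<longrightarrow> u = v)"

text \<open>For weakly modular \<open>L\<close> this is the pseudocomplement of
  \<open>\<theta>\<close> in the congruence lattice: a congruence meeting \<open>\<theta>\<close>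
  trivially collapses the whole interval of each of its pairs, so \<open>\<theta>\<close> must
  separate that interval.\<close>

definition Con_star :: "'a gorder \<Rightarrow> ('a \<times> 'a) set \<Rightarrow> ('a \<times> 'a) set" where
  "Con_star L \<theta> = {(x, y). x \<in> carrier L \<and> y \<in> carrier L \<and>
     separates_interval L \<theta> (x \<sqinter>\<^bsub>L\<^esub> y) (x \<squnion>\<^bsub>L\<^esub> y)}"

text \<open>Weak modularity is usually phrased through weak projectivity of intervals. Here its
  effect on the intervals separated by a congruence is the definition: they are stable under both
  translations and under gluing at a common endpoint.\<close>

definition weakly_modular_lattice :: "'a gorder \<Rightarrow> bool" where
  "weakly_modular_lattice L \<longleftrightarrow> lattice L \<and>
    (\<forall>\<theta> \<in> Con L. \<forall>x \<in> carrier L. \<forall>y \<in> carrier L. x \<sqsubseteq>\<^bsub>L\<^esub> y \<longrightarrow>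
      (separates_interval L \<theta> x y \<longrightarrow> (\<forall>t \<in> carrier L.
        separates_interval L \<theta> (x \<squnion>\<^bsub>L\<^esub> t) (y \<squnion>\<^bsub>L\<^esub> t) \<and>
        separates_interval L \<theta> (x \<sqinter>\<^bsub>L\<^esub> t) (y \<sqinter>\<^bsub>L\<^esub> t) \<and>
        (y \<sqsubseteq>\<^bsub>L\<^esub> t \<and> separates_interval L \<theta> y t \<longrightarrow> separates_interval L \<theta> x t))))"

lemma separates_intervalI:
  fixes L (structure)
  assumes "\<And>u v. \<lbrakk>u \<in> carrier L; v \<in> carrier L; x \<sqsubseteq> u; u \<sqsubseteq> v; v \<sqsubseteq> y; (u, v) \<in> \<theta>\<rbrakk> \<Longrightarrow> u = v"
  shows "separates_interval L \<theta> x y"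
  using assms unfolding separates_interval_def by blast

lemma separates_intervalD:
  fixes L (structure)
  assumes "separates_interval L \<theta> x y"
    and "u \<in> carrier L" "v \<in> carrier L" "x \<sqsubseteq> u" "u \<sqsubseteq> v" "v \<sqsubseteq> y" "(u, v) \<in> \<theta>"
  shows "u = v"
  using assms unfolding separates_interval_def by blast

lemma
  fixes L (structure)
  assumes "weakly_modular_lattice L" "\<theta> \<in> Con L" "x \<in> carrier L" "y \<in> carrier L" "t \<in> carrier L"
    and "x \<sqsubseteq> y" "separates_interval L \<theta> x y"
  shows separates_interval_join: "separates_interval L \<theta> (x \<squnion> t) (y \<squnion> t)"
    and separates_interval_meet: "separates_interval L \<theta> (x \<sqinter> t) (y \<sqinter> t)"
    and separates_interval_trans:
      "y \<sqsubseteq> t \<Longrightarrow> separates_interval L \<theta> y t \<Longrightarrow> separates_interval L \<theta> x t"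
  using assms unfolding weakly_modular_lattice_def by metis+

text \<open>Among the conditions of \<open>Con_of_intervals\<close>, reflexivity and passage to
  subintervals hold in every lattice; the other three are the clauses of weak modularity.\<close>

lemma Con_star_in_Con:
  assumes "weakly_modular_lattice L" "\<theta> \<in> Con L"
  shows "Con_star L \<theta> \<in> Con L"
proof -
  interpret lattice L using assms(1) by (simp add: weakly_modular_lattice_def)
  interpret gorder_lattice L ..
  show ?thesis
    unfolding Con_star_def
  proof (rule Con_of_intervals)
    fix x y a b
    assume *: "x \<in> carrier L" "y \<in> carrier L" "a \<in> carrier L" "b \<in> carrier L"
      "x \<sqsubseteq>\<^bsub>L\<^esub> a" "a \<sqsubseteq>\<^bsub>L\<^esub> b" "b \<sqsubseteq>\<^bsub>L\<^esub> y" "separates_interval L \<theta> x y"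
    show "separates_interval L \<theta> a b"
    proof (rule separates_intervalI)
      fix u v assume uv: "u \<in> carrier L" "v \<in> carrier L" "a \<sqsubseteq>\<^bsub>L\<^esub> u" "u \<sqsubseteq>\<^bsub>L\<^esub> v" "v \<sqsubseteq>\<^bsub>L\<^esub> b"
        "(u, v) \<in> \<theta>"
      have "x \<sqsubseteq>\<^bsub>L\<^esub> u" "v \<sqsubseteq>\<^bsub>L\<^esub> y" using * uv by (meson le_trans)+
      then show "u = v" using * uv by (meson separates_intervalD)
    qed
  next
    fix x assume "x \<in> carrier L"
    then show "separates_interval L \<theta> x x"
      by (intro separates_intervalI) (metis le_antisym le_trans)
  qed (rule separates_interval_trans[OF assms] separates_interval_join[OF assms]
        separates_interval_meet[OF assms]; assumption)+
qed

text \<open>A pair in \<open>\<theta>\<close> has its meet and join identified by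
  \<open>\<theta>\<close> too. These are the endpoints of an interval that \<open>\<theta>\<close>
  separates, so they coincide, and the pair with them.\<close>

lemma Con_star_Int:
  assumes "weakly_modular_lattice L" "\<theta> \<in> Con L"
  shows "\<theta> \<inter> Con_star L \<theta> \<subseteq> Id"
proof (clarsimp simp: Con_star_def)
  interpret lattice L using assms(1) by (simp add: weakly_modular_lattice_def)
  interpret gorder_lattice L ..
  fix x y assume *: "(x, y) \<in> \<theta>" "x \<in> carrier L" "y \<in> carrier L"
    and sep: "separates_interval L \<theta> (x \<sqinter>\<^bsub>L\<^esub> y) (x \<squnion>\<^bsub>L\<^esub> y)"
  have yx: "(y, x) \<in> \<theta>" using * assms(2) Con_sym by fast
  have "(x \<sqinter>\<^bsub>L\<^esub> y, x) \<in> \<theta>"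
    using Con_meet[OF assms(2) Con_refl[OF assms(2) *(2)] yx] * by (simp add: meet_absorb1)
  moreover have "(x, x \<squnion>\<^bsub>L\<^esub> y) \<in> \<theta>"
    using Con_join[OF assms(2) Con_refl[OF assms(2) *(2)] *(1)] * by (simp add: join_absorb1)
  ultimately have "(x \<sqinter>\<^bsub>L\<^esub> y, x \<squnion>\<^bsub>L\<^esub> y) \<in> \<theta>" by (rule Con_trans[OF assms(2)])
  then have "x \<sqinter>\<^bsub>L\<^esub> y = x \<squnion>\<^bsub>L\<^esub> y"
    using * by (intro separates_intervalD[OF sep]) (auto simp: meet_le_join)
  then show "x = y"
    using *(2,3) join_left[of x y] join_right[of x y] meet_left[of x y] meet_right[of x y]
    by (intro le_antisym) (auto intro: le_trans)
qed

text \<open>Prime congruences are coatoms of the congruence lattice, the analogue of Krull dimension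
  zero. The basic lattices have this property, and products and ordinal sums inherit it.\<close>

definition primes_maximal :: "'a gorder \<Rightarrow> bool" where
  "primes_maximal L \<longleftrightarrow>
    (\<forall>\<phi> \<in> Spec L. \<forall>\<psi> \<in> Con L. \<phi> \<subseteq> \<psi> \<longrightarrow> \<psi> = \<phi> \<or> \<psi> = carrier L \<times> carrier L)"

text \<open>The assumption \<open>step\<close> replaces the claim that \<open>\<theta>\<close> and
  \<open>\<theta>*\<close> generate the full congruence, so joins of congruences are never formed:
  from any element below the top one can climb strictly along \<open>\<theta>\<close> or
  \<open>\<theta>*\<close>.\<close>

lemma primes_maximal_weakly_modular:
  assumes L: "bounded_lattice L" and wm: "weakly_modular_lattice L"
    and acc: "ascending_chain_condition L"
    and step: "\<And>\<theta> x. \<lbrakk>\<theta> \<in> Con L; x \<in> carrier L; x \<noteq> \<top>\<^bsub>L\<^esub>\<rbrakk>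
      \<Longrightarrow> \<exists>y \<in> carrier L. x \<sqsubset>\<^bsub>L\<^esub> y \<and> (x, y) \<in> \<theta> \<union> Con_star L \<theta>"
  shows "primes_maximal L"
  unfolding primes_maximal_def
proof (intro ballI impI disjCI)
  interpret bounded_lattice L by fact
  fix \<phi> \<psi> assume \<phi>: "\<phi> \<in> Spec L" and \<psi>: "\<psi> \<in> Con L" and sub: "\<phi> \<subseteq> \<psi>"
    and ne: "\<psi> \<noteq> carrier L \<times> carrier L"
  show "\<psi> = \<phi>"
  proof (rule ccontr)
    assume "\<psi> \<noteq> \<phi>"
    have "\<phi> \<in> Con L" using \<phi> by (simp add: Spec_def)
    have "\<psi> \<inter> Con_star L \<psi> \<subseteq> \<phi>"
      using Con_star_Int[OF wm \<psi>] Con_refl[OF \<open>\<phi> \<in> Con L\<close>] Con_carrier[OF \<psi>] by fast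
    then have "Con_star L \<psi> \<subseteq> \<phi>"
      using \<phi> \<psi> Con_star_in_Con[OF wm \<psi>] \<open>\<psi> \<noteq> \<phi>\<close> sub unfolding Spec_def by blast
    then have star: "Con_star L \<psi> \<subseteq> \<psi>" using sub by blast
    \<comment> \<open>\<open>?S\<close> is the \<open>\<psi>\<close>-class of the least element. A
      proper \<open>\<psi>\<close> keeps the top out of it, and both kinds of climbing steps stay
      inside it, which yields an infinite ascending chain.\<close>
    let ?S = "{x \<in> carrier L. (\<bottom>\<^bsub>L\<^esub>, x) \<in> \<psi>}"
    have "\<exists>y \<in> ?S. x \<sqsubset>\<^bsub>L\<^esub> y" if "x \<in> ?S" for x
    proof -
      have "x \<noteq> \<top>\<^bsub>L\<^esub>" using Con_eq_full[OF L \<psi>] ne that by blast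
      then have "\<exists>y \<in> carrier L. x \<sqsubset>\<^bsub>L\<^esub> y \<and> (x, y) \<in> \<psi> \<union> Con_star L \<psi>"
        using step[OF \<psi>, of x] that by simp
      then obtain y where y: "y \<in> carrier L" "x \<sqsubset>\<^bsub>L\<^esub> y" "(x, y) \<in> \<psi> \<union> Con_star L \<psi>"
        by (elim bexE conjE)
      then have "(\<bottom>\<^bsub>L\<^esub>, y) \<in> \<psi>" using Con_trans[OF \<psi>, of _ x y] star that by auto
      with y show ?thesis by auto
    qed
    moreover have "\<bottom>\<^bsub>L\<^esub> \<in> ?S" using Con_refl[OF \<psi>] by simp
    ultimately have "\<exists>c. \<forall>n. c n \<in> ?S \<and> c n \<sqsubset>\<^bsub>L\<^esub> c (Suc n)"
      by (intro dependent_nat_choice[of "\<lambda>_ x. x \<in> ?S" "\<lambda>_ x y. x \<sqsubset>\<^bsub>L\<^esub> y"]) auto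
    then show False using acc unfolding ascending_chain_condition_def by fast
  qed
qed

section \<open>Finite modular lattices\<close>

lemma finite_ascending_chain_condition:
  assumes "partial_order L" "finite (carrier L)"
  shows "ascending_chain_condition L"
  unfolding ascending_chain_condition_def
proof
  interpret partial_order L by fact
  assume "\<exists>c :: nat \<Rightarrow> 'a. \<forall>n. c n \<in> carrier L \<and> c n \<sqsubset>\<^bsub>L\<^esub> c (Suc n)"
  then obtain c :: "nat \<Rightarrow> 'a" where c: "\<And>n. c n \<in> carrier L" "\<And>n. c n \<sqsubset>\<^bsub>L\<^esub> c (Suc n)" by blast
  have less: "c m \<sqsubset>\<^bsub>L\<^esub> c n" if "m < n" for m n
    using that
  proof (induction n)
    case (Suc n)
    then show ?case
      using c(2)[of n] lless_trans[of "c m" "c n" "c (Suc n)"] c(1) by (auto simp: less_Suc_eq)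
  qed simp
  have "inj c"
  proof (rule injI, rule ccontr)
    fix m n assume "c m = c n" "m \<noteq> n"
    then show False using less[of m n] less[of n m] by (cases m n rule: linorder_cases) (auto simp: lless_eq)
  qed
  then have "infinite (range c)" using finite_imageD by auto
  moreover have "range c \<subseteq> carrier L" using c(1) by auto
  ultimately show False using infinite_super assms(2) by metis
qed

text \<open>Modularity gives cancellation: comparable elements with equal meets and equal joins with
  a third one coincide. A collapsed pair is carried into the separated interval by one operation,
  becomes equal there, and the other operation agrees for order reasons or by a second
  separation.\<close>

lemma modular_weakly_modular:
  assumes "modular_lattice L"
  shows "weakly_modular_lattice L"
proof -
  interpret lattice L using assms by (simp add: modular_lattice_def)
  interpret gorder_lattice L ..
  \<comment> \<open>Given \<open>u\<close> below \<open>v\<close>, the inequalities say that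
    \<open>u\<close> and \<open>v\<close> have the same meet and the same join with
    \<open>y\<close>.\<close>
  have cancel: "u = v" if "u \<sqsubseteq>\<^bsub>L\<^esub> v" "u \<sqinter>\<^bsub>L\<^esub> y \<sqsubseteq>\<^bsub>L\<^esub> u" "v \<sqinter>\<^bsub>L\<^esub> y \<sqsubseteq>\<^bsub>L\<^esub> u" "v \<sqsubseteq>\<^bsub>L\<^esub> u \<squnion>\<^bsub>L\<^esub> y"
    and [simp]: "u \<in> carrier L" "v \<in> carrier L" "y \<in> carrier L" for u v y
  proof -
    have "u \<squnion>\<^bsub>L\<^esub> (y \<sqinter>\<^bsub>L\<^esub> v) = (u \<squnion>\<^bsub>L\<^esub> y) \<sqinter>\<^bsub>L\<^esub> v"
      using assms that by (simp add: modular_lattice_def)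
    moreover have "u \<squnion>\<^bsub>L\<^esub> (y \<sqinter>\<^bsub>L\<^esub> v) = u" using that by (simp add: join_absorb1 meet_comm)
    moreover have "(u \<squnion>\<^bsub>L\<^esub> y) \<sqinter>\<^bsub>L\<^esub> v = v" using that by (simp add: meet_absorb2)
    ultimately show ?thesis by simp
  qed
  show ?thesis
    unfolding weakly_modular_lattice_def
  proof (intro conjI ballI impI)
    fix \<theta> x y t
    assume \<theta>: "\<theta> \<in> Con L" and [simp]: "x \<in> carrier L" "y \<in> carrier L" "t \<in> carrier L"
      and xy: "x \<sqsubseteq>\<^bsub>L\<^esub> y" and sep: "separates_interval L \<theta> x y"
    note sepD = separates_intervalD[OF sep]
    show "separates_interval L \<theta> (x \<squnion>\<^bsub>L\<^esub> t) (y \<squnion>\<^bsub>L\<^esub> t)"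
    proof (rule separates_intervalI)
      fix u v assume [simp]: "u \<in> carrier L" "v \<in> carrier L" and uv: "x \<squnion>\<^bsub>L\<^esub> t \<sqsubseteq>\<^bsub>L\<^esub> u" "u \<sqsubseteq>\<^bsub>L\<^esub> v"
        "v \<sqsubseteq>\<^bsub>L\<^esub> y \<squnion>\<^bsub>L\<^esub> t" "(u, v) \<in> \<theta>"
      have xu: "x \<sqsubseteq>\<^bsub>L\<^esub> u" and tu: "t \<sqsubseteq>\<^bsub>L\<^esub> u"
        using uv(1) by (simp_all add: join_le_iff)
      \<comment> \<open>Both meets lie between \<open>x\<close> and \<open>y\<close>, where
        \<open>\<theta>\<close> is trivial. The joins with \<open>y\<close> agree because
        \<open>t\<close> is below \<open>u\<close>.\<close>
      have "u \<sqinter>\<^bsub>L\<^esub> y = v \<sqinter>\<^bsub>L\<^esub> y"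
        by (rule sepD) (simp_all add: uv xu xy le_meet_iff meet_leI1 meet_leI2 Con_meet[OF \<theta>] Con_refl[OF \<theta>])
      moreover have "v \<sqsubseteq>\<^bsub>L\<^esub> u \<squnion>\<^bsub>L\<^esub> y"
        by (rule le_trans[OF uv(3)]) (simp_all add: join_le_iff le_joinI1 le_joinI2 tu)
      ultimately show "u = v"
        using uv meet_left[of u y] by (intro cancel[of u v y]) auto
    qed
    show "separates_interval L \<theta> (x \<sqinter>\<^bsub>L\<^esub> t) (y \<sqinter>\<^bsub>L\<^esub> t)"
    proof (rule separates_intervalI)
      fix u v assume [simp]: "u \<in> carrier L" "v \<in> carrier L" and uv: "x \<sqinter>\<^bsub>L\<^esub> t \<sqsubseteq>\<^bsub>L\<^esub> u" "u \<sqsubseteq>\<^bsub>L\<^esub> v"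
        "v \<sqsubseteq>\<^bsub>L\<^esub> y \<sqinter>\<^bsub>L\<^esub> t" "(u, v) \<in> \<theta>"
      have vy: "v \<sqsubseteq>\<^bsub>L\<^esub> y" and vt: "v \<sqsubseteq>\<^bsub>L\<^esub> t"
        using uv(3) by (simp_all add: le_meet_iff)
      have "u \<squnion>\<^bsub>L\<^esub> x = v \<squnion>\<^bsub>L\<^esub> x"
        by (rule sepD) (simp_all add: uv vy xy join_le_iff le_joinI1 le_joinI2 Con_join[OF \<theta>] Con_refl[OF \<theta>])
      moreover have "v \<sqinter>\<^bsub>L\<^esub> x \<sqsubseteq>\<^bsub>L\<^esub> u"
        by (rule le_trans[OF _ uv(1)]) (simp_all add: le_meet_iff meet_leI1 meet_leI2 vt)
      ultimately show "u = v"
        using uv meet_left[of u x] join_left[of v x] by (intro cancel[of u v x]) auto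
    qed
    assume yt: "y \<sqsubseteq>\<^bsub>L\<^esub> t \<and> separates_interval L \<theta> y t"
    show "separates_interval L \<theta> x t"
    proof (rule separates_intervalI)
      fix u v assume [simp]: "u \<in> carrier L" "v \<in> carrier L" and uv: "x \<sqsubseteq>\<^bsub>L\<^esub> u" "u \<sqsubseteq>\<^bsub>L\<^esub> v"
        "v \<sqsubseteq>\<^bsub>L\<^esub> t" "(u, v) \<in> \<theta>"
      \<comment> \<open>The pair is tested at the gluing point \<open>y\<close>: meets fall into the
        lower interval, joins into the upper one, and \<open>\<theta>\<close> separates
        both.\<close>
      have "u \<sqinter>\<^bsub>L\<^esub> y = v \<sqinter>\<^bsub>L\<^esub> y"
        by (rule sepD) (simp_all add: uv xy le_meet_iff meet_leI1 meet_leI2 Con_meet[OF \<theta>] Con_refl[OF \<theta>])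
      moreover have "u \<squnion>\<^bsub>L\<^esub> y = v \<squnion>\<^bsub>L\<^esub> y"
        by (rule separates_intervalD[OF conjunct2[OF yt]])
          (simp_all add: uv yt join_le_iff le_joinI1 le_joinI2 Con_join[OF \<theta>] Con_refl[OF \<theta>])
      ultimately show "u = v"
        using uv join_left[of v y] meet_left[of u y] by (intro cancel[of u v y]) auto
    qed
  qed (rule lattice_axioms)
qed

text \<open>Finiteness supplies an upper cover \<open>y\<close> of \<open>x\<close>. The interval
  then has just two elements, so \<open>\<theta>\<close> either collapses it or separates
  it.\<close>

lemma primes_maximal_finite_modular:
  assumes L: "bounded_lattice L" and mod: "modular_lattice L" and fin: "finite (carrier L)"
  shows "primes_maximal L"
proof (rule primes_maximal_weakly_modular[OF L modular_weakly_modular[OF mod]])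
  interpret bounded_lattice L by fact
  interpret gorder_lattice L ..
  show "ascending_chain_condition L"
    by (rule finite_ascending_chain_condition[OF _ fin]) unfold_locales
  fix \<theta> x assume x: "x \<in> carrier L" "x \<noteq> \<top>\<^bsub>L\<^esub>"
  let ?above = "\<lambda>y. {z \<in> carrier L. x \<sqsubset>\<^bsub>L\<^esub> z \<and> z \<sqsubseteq>\<^bsub>L\<^esub> y}"
  have "\<top>\<^bsub>L\<^esub> \<in> carrier L \<and> x \<sqsubset>\<^bsub>L\<^esub> \<top>\<^bsub>L\<^esub>" using x by (simp add: lless_eq)
  \<comment> \<open>A cover is found as an element strictly above \<open>x\<close> with the fewest
    elements strictly above \<open>x\<close> and below or equal to it.\<close>
  from ex_has_least_nat[of "\<lambda>y. y \<in> carrier L \<and> x \<sqsubset>\<^bsub>L\<^esub> y", OF this, of "\<lambda>y. card (?above y)"]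
  obtain y where y: "y \<in> carrier L" "x \<sqsubset>\<^bsub>L\<^esub> y"
    and min: "\<forall>z. z \<in> carrier L \<and> x \<sqsubset>\<^bsub>L\<^esub> z \<longrightarrow> card (?above y) \<le> card (?above z)"
    by (elim exE conjE)
  have cover: "z = x \<or> z = y" if z: "z \<in> carrier L" "x \<sqsubseteq>\<^bsub>L\<^esub> z" "z \<sqsubseteq>\<^bsub>L\<^esub> y" for z
  proof (rule ccontr)
    assume ne: "\<not> (z = x \<or> z = y)"
    then have xz: "x \<sqsubset>\<^bsub>L\<^esub> z" using z by (auto simp: lless_eq)
    have "?above z \<subseteq> ?above y" using z y by (auto intro: le_trans)
    moreover have "y \<in> ?above y" using y by simp
    moreover have "y \<notin> ?above z" using z y ne le_antisym[of z y] by auto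
    ultimately have "?above z \<subset> ?above y" by blast
    then have "card (?above z) < card (?above y)" using fin by (intro psubset_card_mono) auto
    then show False using min[rule_format, of z] z(1) xz by linarith
  qed
  have le: "x \<sqsubseteq>\<^bsub>L\<^esub> y" and ne: "x \<noteq> y" using y by (simp_all add: lless_eq)
  have "(x, y) \<in> \<theta> \<union> Con_star L \<theta>"
  proof (cases "(x, y) \<in> \<theta>")
    case False
    have "separates_interval L \<theta> x y"
    proof (rule separates_intervalI)
      fix u v assume uv: "u \<in> carrier L" "v \<in> carrier L" "x \<sqsubseteq>\<^bsub>L\<^esub> u" "u \<sqsubseteq>\<^bsub>L\<^esub> v" "v \<sqsubseteq>\<^bsub>L\<^esub> y"
        "(u, v) \<in> \<theta>"
      have "u \<sqsubseteq>\<^bsub>L\<^esub> y" using le_trans[OF uv(4,5)] uv y by simp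
      moreover have "x \<sqsubseteq>\<^bsub>L\<^esub> v" using le_trans[OF uv(3,4)] uv x by simp
      ultimately show "u = v"
        using cover[of u] cover[of v] uv False le_antisym[of u v] by auto
    qed
    then show ?thesis
      using x y le by (simp add: Con_star_def meet_absorb1 join_absorb2)
  qed simp
  then show "\<exists>y \<in> carrier L. x \<sqsubset>\<^bsub>L\<^esub> y \<and> (x, y) \<in> \<theta> \<union> Con_star L \<theta>"
    using y by (intro bexI[of _ y]) simp_all
qed

section \<open>Relatively complemented lattices with the ascending chain condition\<close>

lemma relatively_complementedE:
  fixes L (structure)
  assumes "relatively_complemented_lattice L" "a \<in> carrier L" "b \<in> carrier L" "x \<in> carrier L"
    "a \<sqsubseteq> x" "x \<sqsubseteq> b"
  obtains y where "y \<in> carrier L" "a \<sqsubseteq> y" "y \<sqsubseteq> b" "x \<sqinter> y = a" "x \<squnion> y = b"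
  using assms unfolding relatively_complemented_lattice_def by metis

text \<open>A collapsed pair is moved to the top \<open>q\<close> of an interval without becoming
  trivial. The witness is the complement of \<open>v\<close> between \<open>u\<close> and
  \<open>q\<close>: joining with it sends \<open>u\<close>, \<open>v\<close> to \<open>w\<close>,
  \<open>q\<close>, and \<open>w = q\<close> would make its meet with \<open>v\<close>, which is
  \<open>u\<close>, equal to \<open>v\<close>.\<close>

lemma relatively_complemented_shift_up:
  fixes L (structure)
  assumes L: "relatively_complemented_lattice L" and \<theta>: "\<theta> \<in> Con L"
    and c: "u \<in> carrier L" "v \<in> carrier L" "q \<in> carrier L"
    and le: "u \<sqsubseteq> v" "v \<sqsubseteq> q" and uv: "(u, v) \<in> \<theta>"
  obtains w where "w \<in> carrier L" "u \<sqsubseteq> w" "w \<sqsubseteq> q" "(w, q) \<in> \<theta>" "w = q \<Longrightarrow> u = v"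
proof -
  interpret lattice L using L by (simp add: relatively_complemented_lattice_def)
  interpret gorder_lattice L ..
  obtain w where w: "w \<in> carrier L" "u \<sqsubseteq> w" "w \<sqsubseteq> q" "v \<sqinter> w = u" "v \<squnion> w = q"
    using relatively_complementedE[OF L c(1,3,2) le] .
  have "(u \<squnion> w, v \<squnion> w) \<in> \<theta>" using Con_join[OF \<theta> uv Con_refl[OF \<theta> w(1)]] .
  then have "(w, q) \<in> \<theta>" using w c by (simp add: join_absorb2)
  moreover have "u = v" if "w = q" using that w c le by (simp add: meet_absorb1)
  ultimately show thesis using that w by simp
qed

text \<open>The dual move to the bottom \<open>p\<close>, with the complement of \<open>u\<close>
  between \<open>p\<close> and \<open>v\<close>.\<close>

lemma relatively_complemented_shift_down:
  fixes L (structure)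
  assumes L: "relatively_complemented_lattice L" and \<theta>: "\<theta> \<in> Con L"
    and c: "p \<in> carrier L" "u \<in> carrier L" "v \<in> carrier L"
    and le: "p \<sqsubseteq> u" "u \<sqsubseteq> v" and uv: "(u, v) \<in> \<theta>"
  obtains w where "w \<in> carrier L" "p \<sqsubseteq> w" "w \<sqsubseteq> v" "(p, w) \<in> \<theta>" "w = p \<Longrightarrow> u = v"
proof -
  interpret lattice L using L by (simp add: relatively_complemented_lattice_def)
  interpret gorder_lattice L ..
  obtain w where w: "w \<in> carrier L" "p \<sqsubseteq> w" "w \<sqsubseteq> v" "u \<sqinter> w = p" "u \<squnion> w = v"
    using relatively_complementedE[OF L c(1,3,2) le] .
  have "(u \<sqinter> w, v \<sqinter> w) \<in> \<theta>" using Con_meet[OF \<theta> uv Con_refl[OF \<theta> w(1)]] .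
  then have "(p, w) \<in> \<theta>" using w c by (simp add: meet_absorb2)
  moreover have "u = v" if "w = p" using that w c le by (simp add: join_absorb1)
  ultimately show thesis using that w by simp
qed

text \<open>Shifting takes over the role of modular cancellation: a collapsed pair is first moved to
  an end of the interval in question, and only then mapped into the separated interval. Triviality
  of the shifted pair gives triviality of the original one.\<close>

lemma relatively_complemented_weakly_modular:
  assumes L: "relatively_complemented_lattice L"
  shows "weakly_modular_lattice L"
proof -
  interpret lattice L using L by (simp add: relatively_complemented_lattice_def)
  interpret gorder_lattice L ..
  show ?thesis
    unfolding weakly_modular_lattice_def
  proof (intro conjI ballI impI)
    fix \<theta> x y t
    assume \<theta>: "\<theta> \<in> Con L" and [simp]: "x \<in> carrier L" "y \<in> carrier L" "t \<in> carrier L"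
      and xy: "x \<sqsubseteq>\<^bsub>L\<^esub> y" and sep: "separates_interval L \<theta> x y"
    note sepD = separates_intervalD[OF sep]
    note simps = join_le_iff le_meet_iff le_joinI1 le_joinI2 meet_leI1 meet_leI2
    show "separates_interval L \<theta> (x \<squnion>\<^bsub>L\<^esub> t) (y \<squnion>\<^bsub>L\<^esub> t)"
    proof (rule separates_intervalI)
      fix u v assume [simp]: "u \<in> carrier L" "v \<in> carrier L" and uv: "x \<squnion>\<^bsub>L\<^esub> t \<sqsubseteq>\<^bsub>L\<^esub> u" "u \<sqsubseteq>\<^bsub>L\<^esub> v"
        "v \<sqsubseteq>\<^bsub>L\<^esub> y \<squnion>\<^bsub>L\<^esub> t" "(u, v) \<in> \<theta>"
      obtain w where [simp]: "w \<in> carrier L" and w: "u \<sqsubseteq>\<^bsub>L\<^esub> w" "w \<sqsubseteq>\<^bsub>L\<^esub> y \<squnion>\<^bsub>L\<^esub> t"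
        "(w, y \<squnion>\<^bsub>L\<^esub> t) \<in> \<theta>" "w = y \<squnion>\<^bsub>L\<^esub> t \<Longrightarrow> u = v"
        by (rule relatively_complemented_shift_up[OF L \<theta> _ _ _ uv(2,3,4)]) simp_all
      have "x \<squnion>\<^bsub>L\<^esub> t \<sqsubseteq>\<^bsub>L\<^esub> w" by (rule le_trans[OF uv(1) w(1)]) simp_all
      then have xw: "x \<sqsubseteq>\<^bsub>L\<^esub> w" "t \<sqsubseteq>\<^bsub>L\<^esub> w" by (simp_all add: simps)
      \<comment> \<open>Meeting with \<open>y\<close> maps the shifted pair into the interval from
        \<open>x\<close> to \<open>y\<close>. Separation there puts \<open>y\<close> below
        \<open>w\<close>; as \<open>t\<close> is below \<open>w\<close> too, \<open>w\<close> is the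
        top of the translated interval.\<close>
      have "(w \<sqinter>\<^bsub>L\<^esub> y, (y \<squnion>\<^bsub>L\<^esub> t) \<sqinter>\<^bsub>L\<^esub> y) \<in> \<theta>"
        by (rule Con_meet[OF \<theta> w(3) Con_refl[OF \<theta>]]) simp
      then have "w \<sqinter>\<^bsub>L\<^esub> y = y"
        by (intro sepD) (simp_all add: simps xy xw meet_absorb2)
      then have "y \<sqsubseteq>\<^bsub>L\<^esub> w" using meet_left[of w y] by simp
      then have "w = y \<squnion>\<^bsub>L\<^esub> t" using w xw by (intro le_antisym) (simp_all add: simps)
      then show "u = v" by (rule w)
    qed
    show "separates_interval L \<theta> (x \<sqinter>\<^bsub>L\<^esub> t) (y \<sqinter>\<^bsub>L\<^esub> t)"
    proof (rule separates_intervalI)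
      fix u v assume [simp]: "u \<in> carrier L" "v \<in> carrier L" and uv: "x \<sqinter>\<^bsub>L\<^esub> t \<sqsubseteq>\<^bsub>L\<^esub> u" "u \<sqsubseteq>\<^bsub>L\<^esub> v"
        "v \<sqsubseteq>\<^bsub>L\<^esub> y \<sqinter>\<^bsub>L\<^esub> t" "(u, v) \<in> \<theta>"
      obtain w where [simp]: "w \<in> carrier L" and w: "x \<sqinter>\<^bsub>L\<^esub> t \<sqsubseteq>\<^bsub>L\<^esub> w" "w \<sqsubseteq>\<^bsub>L\<^esub> v"
        "(x \<sqinter>\<^bsub>L\<^esub> t, w) \<in> \<theta>" "w = x \<sqinter>\<^bsub>L\<^esub> t \<Longrightarrow> u = v"
        by (rule relatively_complemented_shift_down[OF L \<theta> _ _ _ uv(1,2,4)]) simp_all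
      have "w \<sqsubseteq>\<^bsub>L\<^esub> y \<sqinter>\<^bsub>L\<^esub> t" by (rule le_trans[OF w(2) uv(3)]) simp_all
      then have wy: "w \<sqsubseteq>\<^bsub>L\<^esub> y" "w \<sqsubseteq>\<^bsub>L\<^esub> t" by (simp_all add: simps)
      have "((x \<sqinter>\<^bsub>L\<^esub> t) \<squnion>\<^bsub>L\<^esub> x, w \<squnion>\<^bsub>L\<^esub> x) \<in> \<theta>"
        by (rule Con_join[OF \<theta> w(3) Con_refl[OF \<theta>]]) simp
      then have "x = w \<squnion>\<^bsub>L\<^esub> x"
        by (intro sepD) (simp_all add: simps xy wy join_absorb2)
      then have "w \<sqsubseteq>\<^bsub>L\<^esub> x" using join_left[of w x] by simp
      then have "w = x \<sqinter>\<^bsub>L\<^esub> t" using w wy by (intro le_antisym) (simp_all add: simps)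
      then show "u = v" by (rule w)
    qed
    assume yt: "y \<sqsubseteq>\<^bsub>L\<^esub> t \<and> separates_interval L \<theta> y t"
    show "separates_interval L \<theta> x t"
    proof (rule separates_intervalI)
      fix u v assume [simp]: "u \<in> carrier L" "v \<in> carrier L" and uv: "x \<sqsubseteq>\<^bsub>L\<^esub> u" "u \<sqsubseteq>\<^bsub>L\<^esub> v"
        "v \<sqsubseteq>\<^bsub>L\<^esub> t" "(u, v) \<in> \<theta>"
      obtain w where [simp]: "w \<in> carrier L" and w: "x \<sqsubseteq>\<^bsub>L\<^esub> w" "w \<sqsubseteq>\<^bsub>L\<^esub> v"
        "(x, w) \<in> \<theta>" "w = x \<Longrightarrow> u = v"
        by (rule relatively_complemented_shift_down[OF L \<theta> _ _ _ uv(1,2,4)]) simp_all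
      have wt: "w \<sqsubseteq>\<^bsub>L\<^esub> t" by (rule le_trans[OF w(2) uv(3)]) simp_all
      \<comment> \<open>The pair \<open>x\<close>, \<open>w\<close> is tested on both sides of
        \<open>y\<close>. The upper interval shows that \<open>w\<close> is below \<open>y\<close>,
        and then the lower one gives \<open>w = x\<close>.\<close>
      have "(x \<sqinter>\<^bsub>L\<^esub> y, w \<sqinter>\<^bsub>L\<^esub> y) \<in> \<theta>"
        by (rule Con_meet[OF \<theta> w(3) Con_refl[OF \<theta>]]) simp
      then have 1: "x = w \<sqinter>\<^bsub>L\<^esub> y"
        by (intro sepD) (simp_all add: simps xy w meet_absorb1)
      have "(x \<squnion>\<^bsub>L\<^esub> y, w \<squnion>\<^bsub>L\<^esub> y) \<in> \<theta>"
        by (rule Con_join[OF \<theta> w(3) Con_refl[OF \<theta>]]) simp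
      then have "y = w \<squnion>\<^bsub>L\<^esub> y"
        by (intro separates_intervalD[OF conjunct2[OF yt]])
          (simp_all add: simps xy wt yt join_absorb2)
      then have "w \<sqsubseteq>\<^bsub>L\<^esub> y" using join_left[of w y] by simp
      then have "w = x" using 1 by (simp add: meet_absorb1)
      then show "u = v" by (rule w)
    qed
  qed (rule lattice_axioms)
qed

lemma primes_maximal_relatively_complemented:
  assumes L: "bounded_lattice L" and rc: "relatively_complemented_lattice L"
    and acc: "ascending_chain_condition L"
  shows "primes_maximal L"
proof (rule primes_maximal_weakly_modular[OF L relatively_complemented_weakly_modular[OF rc] acc])
  interpret bounded_lattice L by fact
  interpret gorder_lattice L ..
  fix \<theta> x assume \<theta>: "\<theta> \<in> Con L" and x: "x \<in> carrier L" "x \<noteq> \<top>\<^bsub>L\<^esub>"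
  show "\<exists>y \<in> carrier L. x \<sqsubset>\<^bsub>L\<^esub> y \<and> (x, y) \<in> \<theta> \<union> Con_star L \<theta>"
  proof (cases "\<exists>y \<in> carrier L. x \<sqsubset>\<^bsub>L\<^esub> y \<and> (x, y) \<in> \<theta>")
    case True
    then show ?thesis by (elim bexE) (rule bexI, simp_all)
  next
    case False
    \<comment> \<open>If \<open>\<theta>\<close> identifies \<open>x\<close> with nothing strictly
      above it, then it separates everything above \<open>x\<close>, since any collapsed pair there
      could be shifted down to \<open>x\<close>. The climb along \<open>\<theta>*\<close> then
      reaches the top in one step.\<close>
    have "separates_interval L \<theta> x \<top>\<^bsub>L\<^esub>"
    proof (rule separates_intervalI)
      fix u v assume uv: "u \<in> carrier L" "v \<in> carrier L" "x \<sqsubseteq>\<^bsub>L\<^esub> u" "u \<sqsubseteq>\<^bsub>L\<^esub> v" "(u, v) \<in> \<theta>"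
      obtain w where w: "w \<in> carrier L" "x \<sqsubseteq>\<^bsub>L\<^esub> w" "(x, w) \<in> \<theta>" "w = x \<Longrightarrow> u = v"
        by (rule relatively_complemented_shift_down[OF rc \<theta> x(1) uv]) simp_all
      have "\<not> x \<sqsubset>\<^bsub>L\<^esub> w" using False w by metis
      then have "w = x" using w by (simp add: lless_eq)
      then show "u = v" by (rule w)
    qed
    then have "(x, \<top>\<^bsub>L\<^esub>) \<in> Con_star L \<theta>"
      using x by (simp add: Con_star_def meet_absorb1 join_absorb2)
    then show ?thesis using x by (intro bexI[of _ "\<top>\<^bsub>L\<^esub>"]) (simp_all add: lless_eq)
  qed
qed

section \<open>Congruences with two classes\<close>

text \<open>A pair of \<open>\<alpha>\<close> outside \<open>\<phi>\<close> cannot have both entries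
  in one class, so it crosses from the class of \<bottom> to that of \<top>. This drives both the
  primality of two-class congruences and maximality in the distributive case.\<close>

lemma two_classes_separate:
  fixes L (structure)
  assumes L: "bounded_lattice L" and \<phi>: "\<phi> \<in> Con L" and \<alpha>: "\<alpha> \<in> Con L" and ne: "\<not> \<alpha> \<subseteq> \<phi>"
    and two: "\<And>x. x \<in> carrier L \<Longrightarrow> (\<bottom>, x) \<in> \<phi> \<or> (x, \<top>) \<in> \<phi>"
  obtains p q where "(p, q) \<in> \<alpha>" "p \<sqsubseteq> q" "(\<bottom>, p) \<in> \<phi>" "(q, \<top>) \<in> \<phi>"
proof -
  interpret bounded_lattice L by fact
  interpret gorder_lattice L ..
  have "\<exists>p q. (p, q) \<in> \<alpha> \<and> (p, q) \<notin> \<phi>" using ne by (simp add: subset_iff)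
  then obtain a b where ab: "(a, b) \<in> \<alpha>" "(a, b) \<notin> \<phi>" by (elim exE conjE)
  have [simp]: "a \<in> carrier L" "b \<in> carrier L" using Con_carrier[OF \<alpha> ab(1)] by simp_all
  have notboth: "\<not> ((\<bottom>, a) \<in> \<phi> \<and> (\<bottom>, b) \<in> \<phi>)" "\<not> ((a, \<top>) \<in> \<phi> \<and> (b, \<top>) \<in> \<phi>)"
    using ab(2) Con_trans[OF \<phi> Con_sym[OF \<phi>], of \<bottom> a b] Con_trans[OF \<phi>, of a \<top> b]
      Con_sym[OF \<phi>, of b \<top>] by argo+
  obtain p q where pq: "(p, q) \<in> \<alpha>" "(\<bottom>, p) \<in> \<phi>" "(q, \<top>) \<in> \<phi>"
    using two[of a] two[of b] notboth ab(1) Con_sym[OF \<alpha> ab(1)] that by auto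
  have [simp]: "p \<in> carrier L" "q \<in> carrier L" using Con_carrier[OF \<alpha> pq(1)] by simp_all
  \<comment> \<open>Replacing \<open>p\<close> by \<open>p \<sqinter> q\<close> makes the crossing
    pair comparable and leaves the lower entry in the class of \<bottom>.\<close>
  have "(p \<sqinter> q, q \<sqinter> q) \<in> \<alpha>" using Con_meet[OF \<alpha> pq(1) Con_refl[OF \<alpha>]] by simp
  moreover have "(\<bottom> \<sqinter> q, p \<sqinter> q) \<in> \<phi>" using Con_meet[OF \<phi> pq(2) Con_refl[OF \<phi>]] by simp
  ultimately show thesis
    using pq(3) by (intro that[of "p \<sqinter> q" q]) (simp_all add: meet_absorb1 meet_right)
qed

text \<open>If neither \<open>\<alpha>\<close> nor \<open>\<beta>\<close> is contained in
  \<open>\<phi>\<close>, each has a crossing pair. Interleaving the two pairs produces a crossing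
  pair of the intersection, which \<open>\<phi>\<close> would then contain.\<close>

lemma two_classes_Spec:
  fixes L (structure)
  assumes L: "bounded_lattice L" and \<phi>: "\<phi> \<in> Con L" and proper: "\<phi> \<noteq> carrier L \<times> carrier L"
    and two: "\<And>x. x \<in> carrier L \<Longrightarrow> (\<bottom>, x) \<in> \<phi> \<or> (x, \<top>) \<in> \<phi>"
  shows "\<phi> \<in> Spec L"
  unfolding Spec_def
proof (intro CollectI conjI ballI impI \<phi> proper, rule ccontr)
  interpret bounded_lattice L by fact
  interpret gorder_lattice L ..
  fix \<alpha> \<beta> assume \<alpha>: "\<alpha> \<in> Con L" and \<beta>: "\<beta> \<in> Con L" and sub: "\<alpha> \<inter> \<beta> \<subseteq> \<phi>"
    and ne: "\<not> (\<alpha> \<subseteq> \<phi> \<or> \<beta> \<subseteq> \<phi>)"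
  obtain p q where pq: "(p, q) \<in> \<alpha>" "p \<sqsubseteq> q" "(\<bottom>, p) \<in> \<phi>" "(q, \<top>) \<in> \<phi>"
    using two_classes_separate[OF L \<phi> \<alpha> _ two] ne by metis
  obtain r s where rs: "(r, s) \<in> \<beta>" "r \<sqsubseteq> s" "(\<bottom>, r) \<in> \<phi>" "(s, \<top>) \<in> \<phi>"
    using two_classes_separate[OF L \<phi> \<beta> _ two] ne by metis
  have [simp]: "p \<in> carrier L" "q \<in> carrier L" "r \<in> carrier L" "s \<in> carrier L"
    using Con_carrier[OF \<alpha> pq(1)] Con_carrier[OF \<beta> rs(1)] by simp_all
  txt \<open>The pair \<open>(?x, ?e)\<close> lies in \<open>\<alpha> \<inter> \<beta>\<close> but joins the class of \<open>\<bottom>\<close> to that of \<open>\<top>\<close>.\<close>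
  let ?x = "(p \<sqinter> s) \<squnion> (q \<sqinter> r)" and ?e = "q \<sqinter> s"
  have "(p \<sqinter> s, ?e) \<in> \<alpha>" by (rule Con_meet[OF \<alpha> pq(1) Con_refl[OF \<alpha>]]) simp
  then have "(?x, ?e \<squnion> (q \<sqinter> r)) \<in> \<alpha>" by (rule Con_join[OF \<alpha> _ Con_refl[OF \<alpha>]]) simp
  moreover have "(q \<sqinter> r, ?e) \<in> \<beta>" by (rule Con_meet[OF \<beta> Con_refl[OF \<beta>] rs(1)]) simp
  then have "(?x, (p \<sqinter> s) \<squnion> ?e) \<in> \<beta>" by (intro Con_join[OF \<beta> Con_refl[OF \<beta>]]) simp_all
  \<comment> \<open>The comparabilities of the crossing pairs make both right-hand entries absorb to
    the same \<open>?e\<close>, so one pair lies in both congruences.\<close>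
  moreover have "?e \<squnion> (q \<sqinter> r) = ?e" "(p \<sqinter> s) \<squnion> ?e = ?e"
    using pq(2) rs(2) by (simp_all add: join_absorb1 join_absorb2 meet_mono)
  ultimately have xe: "(?x, ?e) \<in> \<phi>" using sub by auto
  have "(\<bottom> \<sqinter> s, p \<sqinter> s) \<in> \<phi>" by (rule Con_meet[OF \<phi> pq(3) Con_refl[OF \<phi>]]) simp
  moreover have "(q \<sqinter> \<bottom>, q \<sqinter> r) \<in> \<phi>" by (rule Con_meet[OF \<phi> Con_refl[OF \<phi>] rs(3)]) simp
  ultimately have "((\<bottom> \<sqinter> s) \<squnion> (q \<sqinter> \<bottom>), ?x) \<in> \<phi>" by (rule Con_join[OF \<phi>])
  then have "(\<bottom>, ?x) \<in> \<phi>" by (simp add: meet_absorb1 meet_absorb2 join_absorb1)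
  moreover have "(?e, \<top> \<sqinter> \<top>) \<in> \<phi>" by (rule Con_meet[OF \<phi> pq(4) rs(4)])
  then have "(?e, \<top>) \<in> \<phi>" by (simp add: meet_absorb1)
  ultimately have "(\<bottom>, \<top>) \<in> \<phi>" using xe Con_trans[OF \<phi>] by metis
  then show False using proper Con_eq_full[OF L \<phi>] by simp
qed

text \<open>Having equal meets with \<open>a\<close> identifies \<open>a\<close> with \<top>, and
  having equal joins with \<open>a\<close> identifies it with \<bottom>. These congruences intersect
  in the diagonal by distributive cancellation, so a prime contains one of them.\<close>

lemma Spec_distributive_two_classes:
  fixes L (structure)
  assumes L: "bounded_lattice L" and dist: "distributive_lattice L" and \<phi>: "\<phi> \<in> Spec L"
    and a [simp]: "a \<in> carrier L"
  shows "(\<bottom>, a) \<in> \<phi> \<or> (a, \<top>) \<in> \<phi>"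
proof -
  interpret bounded_lattice L by fact
  interpret gorder_lattice L ..
  have meet_join: "x \<sqinter> (y \<squnion> z) = (x \<sqinter> y) \<squnion> (x \<sqinter> z)"
    if "x \<in> carrier L" "y \<in> carrier L" "z \<in> carrier L" for x y z
    using dist that by (simp add: distributive_lattice_def)
  \<comment> \<open>The dual distributive law, derived from the one in the definition, makes
    \<open>?\<beta>\<close> compatible with meets.\<close>
  have join_meet: "(x \<sqinter> y) \<squnion> a = (x \<squnion> a) \<sqinter> (y \<squnion> a)"
    if [simp]: "x \<in> carrier L" "y \<in> carrier L" for x y
  proof -
    have "(x \<squnion> a) \<sqinter> (y \<squnion> a) = ((x \<squnion> a) \<sqinter> y) \<squnion> ((x \<squnion> a) \<sqinter> a)" by (simp add: meet_join)
    also have "(x \<squnion> a) \<sqinter> a = a" by (simp add: meet_absorb2 join_right)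
    also have "(x \<squnion> a) \<sqinter> y = (x \<sqinter> y) \<squnion> (y \<sqinter> a)"
      using meet_join[of y x a] by (simp add: meet_comm[of L y])
    also have "(x \<sqinter> y) \<squnion> (y \<sqinter> a) \<squnion> a = (x \<sqinter> y) \<squnion> ((y \<sqinter> a) \<squnion> a)"
      by (simp add: join_assoc)
    also have "(y \<sqinter> a) \<squnion> a = a" by (simp add: join_absorb2 meet_right)
    finally show ?thesis by simp
  qed
  let ?\<alpha> = "{(x, y). x \<in> carrier L \<and> y \<in> carrier L \<and> x \<sqinter> a = y \<sqinter> a}"
  let ?\<beta> = "{(x, y). x \<in> carrier L \<and> y \<in> carrier L \<and> x \<squnion> a = y \<squnion> a}"
  have "?\<alpha> \<in> Con L"
  proof (rule ConI)
    fix x x' y y' assume "(x, x') \<in> ?\<alpha>" "(y, y') \<in> ?\<alpha>"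
    then have c [simp]: "x \<in> carrier L" "x' \<in> carrier L" "y \<in> carrier L" "y' \<in> carrier L"
      and eq: "x \<sqinter> a = x' \<sqinter> a" "y \<sqinter> a = y' \<sqinter> a" by simp_all
    show "(x \<squnion> y, x' \<squnion> y') \<in> ?\<alpha>"
      using eq by (simp add: meet_join meet_comm[of L _ a])
    have "(x \<sqinter> y) \<sqinter> a = x \<sqinter> (y' \<sqinter> a)" by (simp add: meet_assoc eq)
    also have "\<dots> = (x \<sqinter> a) \<sqinter> y'" by (simp add: meet_assoc meet_comm[of L a y'])
    also have "\<dots> = (x' \<sqinter> y') \<sqinter> a" by (simp add: eq meet_assoc meet_comm[of L a y'])
    finally show "(x \<sqinter> y, x' \<sqinter> y') \<in> ?\<alpha>" by simp
  qed auto
  moreover have "?\<beta> \<in> Con L"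
  proof (rule ConI)
    fix x x' y y' assume "(x, x') \<in> ?\<beta>" "(y, y') \<in> ?\<beta>"
    then have c [simp]: "x \<in> carrier L" "x' \<in> carrier L" "y \<in> carrier L" "y' \<in> carrier L"
      and eq: "x \<squnion> a = x' \<squnion> a" "y \<squnion> a = y' \<squnion> a" by simp_all
    show "(x \<sqinter> y, x' \<sqinter> y') \<in> ?\<beta>" using eq by (simp add: join_meet)
    have "(x \<squnion> y) \<squnion> a = x \<squnion> (y' \<squnion> a)" by (simp add: join_assoc eq)
    also have "\<dots> = (x \<squnion> a) \<squnion> y'" by (simp add: join_assoc join_comm[of L a y'])
    also have "\<dots> = (x' \<squnion> y') \<squnion> a" by (simp add: eq join_assoc join_comm[of L a y'])
    finally show "(x \<squnion> y, x' \<squnion> y') \<in> ?\<beta>" by simp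
  qed auto
  moreover have "?\<alpha> \<inter> ?\<beta> \<subseteq> \<phi>"
  proof clarify
    fix x y assume [simp]: "x \<in> carrier L" "y \<in> carrier L"
      and eq: "x \<sqinter> a = y \<sqinter> a" "x \<squnion> a = y \<squnion> a"
    have "x = x \<sqinter> (x \<squnion> a)" by (simp add: meet_absorb1 join_left)
    also have "\<dots> = (x \<sqinter> y) \<squnion> (x \<sqinter> a)" by (simp add: eq(2) meet_join)
    also have "\<dots> = y \<sqinter> (x \<squnion> a)" by (simp add: eq(1) meet_join meet_comm[of L x y])
    also have "\<dots> = y" by (simp add: eq(2) meet_absorb1 join_left)
    finally show "(x, y) \<in> \<phi>" using \<phi> Con_refl[of \<phi> L] by (simp add: Spec_def)
  qed
  ultimately have "?\<alpha> \<subseteq> \<phi> \<or> ?\<beta> \<subseteq> \<phi>"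
    using \<phi> unfolding Spec_def by blast
  moreover have "(a, \<top>) \<in> ?\<alpha>" by (simp add: meet_absorb1 meet_absorb2)
  moreover have "(\<bottom>, a) \<in> ?\<beta>" by (simp add: join_absorb1 join_absorb2)
  ultimately show ?thesis by (metis (no_types, lifting) subsetD)
qed

text \<open>A congruence properly above \<open>\<phi>\<close> contains a pair crossing the two
  classes; since it also contains \<open>\<phi>\<close>, it links \<bottom> to \<top> through that
  pair.\<close>

lemma primes_maximal_distributive:
  assumes L: "bounded_lattice L" and dist: "distributive_lattice L"
  shows "primes_maximal L"
  unfolding primes_maximal_def
proof (intro ballI impI)
  fix \<phi> \<psi> assume \<phi>: "\<phi> \<in> Spec L" and \<psi>: "\<psi> \<in> Con L" and sub: "\<phi> \<subseteq> \<psi>"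
  have "\<phi> \<in> Con L" using \<phi> by (simp add: Spec_def)
  show "\<psi> = \<phi> \<or> \<psi> = carrier L \<times> carrier L"
  proof (cases "\<psi> \<subseteq> \<phi>")
    case False
    obtain p q where "(p, q) \<in> \<psi>" "(\<bottom>\<^bsub>L\<^esub>, p) \<in> \<phi>" "(q, \<top>\<^bsub>L\<^esub>) \<in> \<phi>"
      using two_classes_separate[OF L \<open>\<phi> \<in> Con L\<close> \<psi> False Spec_distributive_two_classes[OF L dist \<phi>]]
      by blast
    then have "(\<bottom>\<^bsub>L\<^esub>, \<top>\<^bsub>L\<^esub>) \<in> \<psi>" using sub Con_trans[OF \<psi>] by blast
    then show ?thesis using Con_eq_full[OF L \<psi>] by simp
  qed (use sub in auto)
qed

section \<open>Subdirect products\<close>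

text \<open>Unlike \<open>bl_hom\<close>, this asks only for the two binary operations, which are
  what congruences see. That both structures are lattices is bundled in, so that it travels with
  compositions and inverses.\<close>

definition lattice_hom :: "'a gorder \<Rightarrow> 'b gorder \<Rightarrow> ('a \<Rightarrow> 'b) \<Rightarrow> bool" where
  "lattice_hom A B f \<longleftrightarrow> lattice A \<and> lattice B \<and> f \<in> carrier A \<rightarrow> carrier B \<and>
    (\<forall>x \<in> carrier A. \<forall>y \<in> carrier A.
      f (x \<squnion>\<^bsub>A\<^esub> y) = f x \<squnion>\<^bsub>B\<^esub> f y \<and> f (x \<sqinter>\<^bsub>A\<^esub> y) = f x \<sqinter>\<^bsub>B\<^esub> f y)"

lemma bl_hom_lattice_hom: "f \<in> bl_hom A B \<Longrightarrow> lattice_hom A B f"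
  by (simp add: bl_hom_def lattice_hom_def join_pres_def meet_pres_def)

lemma lattice_hom_comp: "\<lbrakk>lattice_hom A B f; lattice_hom B C g\<rbrakk> \<Longrightarrow> lattice_hom A C (g \<circ> f)"
  unfolding lattice_hom_def by (simp add: Pi_iff)

lemma lattice_hom_inverse:
  assumes f: "lattice_hom A B f" and bij: "bij_betw f (carrier A) (carrier B)"
  shows "lattice_hom B A (inv_into (carrier A) f)"
proof -
  let ?g = "inv_into (carrier A) f"
  have g: "?g y \<in> carrier A" "f (?g y) = y" if "y \<in> carrier B" for y
    using bij that bij_betw_imp_surj_on[OF bij]
    by (metis inv_into_into, metis f_inv_into_f)
  have gf: "?g (f x) = x" if "x \<in> carrier A" for x
    using bij that by (rule bij_betw_inv_into_left)
  interpret A: lattice A using f by (simp add: lattice_hom_def)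
  show ?thesis
    unfolding lattice_hom_def
  proof (intro conjI ballI funcsetI g)
    fix x y assume "x \<in> carrier B" "y \<in> carrier B"
    then show "?g (x \<squnion>\<^bsub>B\<^esub> y) = ?g x \<squnion>\<^bsub>A\<^esub> ?g y" "?g (x \<sqinter>\<^bsub>B\<^esub> y) = ?g x \<sqinter>\<^bsub>A\<^esub> ?g y"
      using f g gf[of "?g x \<squnion>\<^bsub>A\<^esub> ?g y"] gf[of "?g x \<sqinter>\<^bsub>A\<^esub> ?g y"] by (simp_all add: lattice_hom_def)
  qed (use f in \<open>simp_all add: lattice_hom_def\<close>)
qed

lemma pullback_in_Con:
  assumes f: "lattice_hom A B f" and \<theta>: "\<theta> \<in> Con B"
  shows "pullback A f \<theta> \<in> Con A"
proof (rule ConI)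
  interpret A: lattice A using f by (simp add: lattice_hom_def)
  fix x x' y y' assume "(x, x') \<in> pullback A f \<theta>" "(y, y') \<in> pullback A f \<theta>"
  then show "(x \<squnion>\<^bsub>A\<^esub> y, x' \<squnion>\<^bsub>A\<^esub> y') \<in> pullback A f \<theta>" "(x \<sqinter>\<^bsub>A\<^esub> y, x' \<sqinter>\<^bsub>A\<^esub> y') \<in> pullback A f \<theta>"
    using f Con_join[OF \<theta>, of "f x" "f x'" "f y" "f y'"] Con_meet[OF \<theta>, of "f x" "f x'" "f y" "f y'"]
    by (simp_all add: pullback_def lattice_hom_def)
next
  fix x y z assume "(x, y) \<in> pullback A f \<theta>" "(y, z) \<in> pullback A f \<theta>"
  then show "(x, z) \<in> pullback A f \<theta>"
    using Con_trans[OF \<theta>, of "f x" "f y" "f z"] by (simp add: pullback_def)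
next
  fix x assume "x \<in> carrier A"
  then show "(x, x) \<in> pullback A f \<theta>"
    using f Con_refl[OF \<theta>, of "f x"] by (simp add: pullback_def lattice_hom_def Pi_iff)
qed (auto simp: pullback_def intro: Con_sym[OF \<theta>])

lemma Id_on_in_Con: "lattice L \<Longrightarrow> Id_on (carrier L) \<in> Con L"
proof (rule ConI)
  assume "lattice L"
  then interpret lattice L .
  fix x x' y y' assume "(x, x') \<in> Id_on (carrier L)" "(y, y') \<in> Id_on (carrier L)"
  then show "(x \<squnion>\<^bsub>L\<^esub> y, x' \<squnion>\<^bsub>L\<^esub> y') \<in> Id_on (carrier L)" "(x \<sqinter>\<^bsub>L\<^esub> y, x' \<sqinter>\<^bsub>L\<^esub> y') \<in> Id_on (carrier L)"
    by (auto simp: Id_on_iff)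
qed (auto simp: Id_on_iff)

section \<open>The correspondence theorem for a surjective morphism\<close>

context
  fixes A :: "'a gorder" and B :: "'b gorder" and f
  assumes f: "lattice_hom A B f" and surj: "f ` carrier A = carrier B"
begin

text \<open>Since \<open>\<theta>\<close> contains the kernel of \<open>f\<close>, written as the
  pullback of the diagonal, it is a union of products of fibres. The plain image is therefore
  already transitive and loses nothing under pullback.\<close>

lemma Con_image:
  assumes \<theta>: "\<theta> \<in> Con A" and ker: "pullback A f (Id_on (carrier B)) \<subseteq> \<theta>"
  shows "map_prod f f ` \<theta> \<in> Con B" and "pullback A f (map_prod f f ` \<theta>) = \<theta>"
proof -
  have fc: "f x \<in> carrier B" if "x \<in> carrier A" for x using surj that by blast
  \<comment> \<open>Membership of the image can be tested on any representatives: the kernel links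
    them to the ones supplied by the image.\<close>
  have mem: "(x, y) \<in> \<theta>" if x: "x \<in> carrier A" and y: "y \<in> carrier A" and xy: "(f x, f y) \<in> map_prod f f ` \<theta>" for x y
  proof -
    obtain x' y' where xy': "(x', y') \<in> \<theta>" "f x = f x'" "f y = f y'" using xy by auto
    have c: "x' \<in> carrier A" "y' \<in> carrier A" using Con_carrier[OF \<theta> xy'(1)] by simp_all
    have "(x, x') \<in> \<theta>" "(y', y) \<in> \<theta>"
      using ker xy' x y c fc unfolding pullback_def by (auto simp: Id_on_iff subset_iff)
    then show ?thesis using Con_trans[OF \<theta>] xy'(1) by metis
  qed
  have img: "(f x, f y) \<in> map_prod f f ` \<theta>" if "(x, y) \<in> \<theta>" for x y using that by force
  have pre: "\<exists>x\<in>carrier A. u = f x" if "u \<in> carrier B" for u using surj that by blast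
  show "pullback A f (map_prod f f ` \<theta>) = \<theta>"
  proof (intro equalityI subrelI)
    fix x y assume "(x, y) \<in> \<theta>"
    then show "(x, y) \<in> pullback A f (map_prod f f ` \<theta>)"
      using img Con_carrier[OF \<theta>] unfolding pullback_def by simp
  qed (simp add: pullback_def mem)
  have "map_prod f f ` \<theta> \<subseteq> carrier B \<times> carrier B" using Con_carrier[OF \<theta>] fc by auto
  then have rep: "\<exists>x y. (x, y) \<in> \<theta> \<and> u = f x \<and> v = f y" if "(u, v) \<in> map_prod f f ` \<theta>" for u v
    using that by auto
  show "map_prod f f ` \<theta> \<in> Con B"
  proof (rule ConI)
    show "map_prod f f ` \<theta> \<subseteq> carrier B \<times> carrier B" by fact
  next
    fix u assume "u \<in> carrier B"
    then obtain x where "x \<in> carrier A" "u = f x" using pre by blast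
    then show "(u, u) \<in> map_prod f f ` \<theta>" using img Con_refl[OF \<theta>] by simp
  next
    fix u v assume "(u, v) \<in> map_prod f f ` \<theta>"
    then obtain x y where "(x, y) \<in> \<theta>" "u = f x" "v = f y" using rep by blast
    then show "(v, u) \<in> map_prod f f ` \<theta>" using img Con_sym[OF \<theta>] by simp
  next
    fix u v w assume uv: "(u, v) \<in> map_prod f f ` \<theta>" and vw: "(v, w) \<in> map_prod f f ` \<theta>"
    obtain x y where xy: "(x, y) \<in> \<theta>" "u = f x" "v = f y" using rep[OF uv] by blast
    obtain y' z where yz: "(y', z) \<in> \<theta>" "v = f y'" "w = f z" using rep[OF vw] by blast
    \<comment> \<open>The middle element \<open>v\<close> has two representatives, \<open>y\<close>
      and \<open>y'\<close>; \<open>mem\<close> allows the second pair to start from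
      \<open>y\<close> instead.\<close>
    have "(y, z) \<in> \<theta>"
      using mem[of y z] vw xy yz Con_carrier[OF \<theta> xy(1)] Con_carrier[OF \<theta> yz(1)] by simp
    then have "(x, z) \<in> \<theta>" by (rule Con_trans[OF \<theta> xy(1)])
    then show "(u, w) \<in> map_prod f f ` \<theta>" using img xy yz by simp
  next
    fix u u' v v' assume u: "(u, u') \<in> map_prod f f ` \<theta>" and v: "(v, v') \<in> map_prod f f ` \<theta>"
    obtain x x' where x: "(x, x') \<in> \<theta>" "u = f x" "u' = f x'" using rep[OF u] by blast
    obtain y y' where y: "(y, y') \<in> \<theta>" "v = f y" "v' = f y'" using rep[OF v] by blast
    show "(u \<squnion>\<^bsub>B\<^esub> v, u' \<squnion>\<^bsub>B\<^esub> v') \<in> map_prod f f ` \<theta>"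
      using f img[OF Con_join[OF \<theta> x(1) y(1)]] x y Con_carrier[OF \<theta> x(1)] Con_carrier[OF \<theta> y(1)]
      by (simp add: lattice_hom_def)
    show "(u \<sqinter>\<^bsub>B\<^esub> v, u' \<sqinter>\<^bsub>B\<^esub> v') \<in> map_prod f f ` \<theta>"
      using f img[OF Con_meet[OF \<theta> x(1) y(1)]] x y Con_carrier[OF \<theta> x(1)] Con_carrier[OF \<theta> y(1)]
      by (simp add: lattice_hom_def)
  qed
qed

text \<open>Pullback commutes with intersection and brings the image back to \<open>\<phi>\<close>,
  so primality is tested in \<open>A\<close>; surjectivity carries the resulting inclusion back to
  \<open>B\<close>.\<close>

lemma Spec_image:
  assumes \<phi>: "\<phi> \<in> Spec A" and ker: "pullback A f (Id_on (carrier B)) \<subseteq> \<phi>"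
  shows "map_prod f f ` \<phi> \<in> Spec B"
proof -
  have "\<phi> \<in> Con A" using \<phi> by (simp add: Spec_def)
  note img = Con_image[OF this ker]
  have fc: "f x \<in> carrier B" if "x \<in> carrier A" for x using surj that by blast
  have "map_prod f f ` \<phi> \<noteq> carrier B \<times> carrier B"
  proof
    assume "map_prod f f ` \<phi> = carrier B \<times> carrier B"
    then have "pullback A f (map_prod f f ` \<phi>) = carrier A \<times> carrier A"
      using fc by (auto simp: pullback_def)
    then show False using \<phi> img(2) by (simp add: Spec_def)
  qed
  moreover have "\<alpha> \<subseteq> map_prod f f ` \<phi> \<or> \<beta> \<subseteq> map_prod f f ` \<phi>"
    if \<alpha>: "\<alpha> \<in> Con B" and \<beta>: "\<beta> \<in> Con B" and sub: "\<alpha> \<inter> \<beta> \<subseteq> map_prod f f ` \<phi>" for \<alpha> \<beta>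
  proof -
    have "pullback A f \<alpha> \<inter> pullback A f \<beta> \<subseteq> pullback A f (map_prod f f ` \<phi>)"
      using sub unfolding pullback_def by blast
    then have "pullback A f \<alpha> \<subseteq> \<phi> \<or> pullback A f \<beta> \<subseteq> \<phi>"
      using \<phi> pullback_in_Con[OF f \<alpha>] pullback_in_Con[OF f \<beta>] unfolding img(2) Spec_def by simp
    moreover have "\<gamma> \<subseteq> map_prod f f ` \<phi>" if \<gamma>: "\<gamma> \<in> Con B" "pullback A f \<gamma> \<subseteq> \<phi>" for \<gamma>
    proof clarify
      fix u v assume uv: "(u, v) \<in> \<gamma>"
      obtain x y where xy: "x \<in> carrier A" "y \<in> carrier A" "u = f x" "v = f y"
        using Con_carrier[OF \<gamma>(1) uv] surj by blast
      then have "(x, y) \<in> \<phi>" using uv \<gamma>(2) unfolding pullback_def by blast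
      then show "(u, v) \<in> map_prod f f ` \<phi>" using xy by force
    qed
    ultimately show ?thesis using \<alpha> \<beta> by blast
  qed
  ultimately show ?thesis using img(1) by (simp add: Spec_def)
qed

text \<open>Both congruences lie above the kernel, so the correspondence moves the comparison to
  \<open>B\<close> and back without losing information.\<close>

lemma Spec_above_kernel_maximal:
  assumes B: "primes_maximal B" and \<phi>: "\<phi> \<in> Spec A"
    and ker: "pullback A f (Id_on (carrier B)) \<subseteq> \<phi>"
    and \<psi>: "\<psi> \<in> Con A" and sub: "\<phi> \<subseteq> \<psi>"
  shows "\<psi> = \<phi> \<or> \<psi> = carrier A \<times> carrier A"
proof -
  have "\<phi> \<in> Con A" using \<phi> by (simp add: Spec_def)
  note img_\<phi> = Con_image[OF this ker]
  have ker': "pullback A f (Id_on (carrier B)) \<subseteq> \<psi>" using ker sub by blast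
  note img_\<psi> = Con_image[OF \<psi> ker']
  have fc: "f x \<in> carrier B" if "x \<in> carrier A" for x using surj that by blast
  have "map_prod f f ` \<psi> = map_prod f f ` \<phi> \<or> map_prod f f ` \<psi> = carrier B \<times> carrier B"
    using B Spec_image[OF \<phi> ker] img_\<psi>(1) image_mono[OF sub, of "map_prod f f"]
    unfolding primes_maximal_def by simp
  then show ?thesis
  proof
    assume "map_prod f f ` \<psi> = carrier B \<times> carrier B"
    then have "pullback A f (map_prod f f ` \<psi>) = carrier A \<times> carrier A"
      using fc by (auto simp: pullback_def)
    then show ?thesis using img_\<psi>(2) by simp
  qed (use img_\<phi>(2) img_\<psi>(2) in simp)
qed

end

text \<open>Binary primality is iterated by induction. Cutting the intersection down to pairs of the
  carrier makes the empty intersection the full congruence, which a proper \<open>\<phi>\<close>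
  cannot contain; this settles \<open>n = 0\<close>.\<close>

lemma Spec_finite_Inter:
  fixes \<theta> :: "nat \<Rightarrow> ('a \<times> 'a) set"
  assumes L: "lattice L" and \<phi>: "\<phi> \<in> Spec L" and \<theta>: "\<And>i. i < n \<Longrightarrow> \<theta> i \<in> Con L"
    and sub: "{p \<in> carrier L \<times> carrier L. \<forall>i<n. p \<in> \<theta> i} \<subseteq> \<phi>"
  shows "\<exists>i<n. \<theta> i \<subseteq> \<phi>"
  using \<theta> sub
proof (induction n)
  case 0
  then show ?case using \<phi> Con_subset[of \<phi> L] unfolding Spec_def by auto
next
  case (Suc n)
  let ?I = "\<lambda>n. {p \<in> carrier L \<times> carrier L. \<forall>i<n. p \<in> \<theta> i}"
  interpret lattice L by (rule L)
  have I: "?I m \<in> Con L" if "m \<le> n" for m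
    using that
  proof (induction m)
    case 0
    show ?case by (rule ConI) auto
  next
    case (Suc m)
    have "?I (Suc m) = ?I m \<inter> \<theta> m" by (auto simp: less_Suc_eq)
    moreover have "\<dots> \<in> Con L" using Suc \<open>\<And>i. i < Suc n \<Longrightarrow> \<theta> i \<in> Con L\<close> by (intro Con_Int) simp_all
    ultimately show ?case by (rule ssubst)
  qed
  have "?I n \<inter> \<theta> n \<subseteq> ?I (Suc n)" by (auto simp: less_Suc_eq)
  then have "?I n \<inter> \<theta> n \<subseteq> \<phi>" using Suc.prems(2) by (rule subset_trans)
  then have "?I n \<subseteq> \<phi> \<or> \<theta> n \<subseteq> \<phi>"
    using \<phi> I[of n] Suc.prems(1)[of n] unfolding Spec_def by simp
  then show ?case
  proof
    assume "?I n \<subseteq> \<phi>"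
    then have "\<exists>i<n. \<theta> i \<subseteq> \<phi>" using Suc.IH Suc.prems(1) by simp
    then show ?thesis using less_SucI by metis
  qed auto
qed

text \<open>Joint injectivity says that the kernels of the maps intersect in the diagonal. A prime
  contains one of these kernels, and maximality is inherited from the corresponding
  \<open>M i\<close>.\<close>

lemma primes_maximal_subdirect:
  fixes L :: "'a gorder" and M :: "nat \<Rightarrow> 'b gorder"
  assumes L: "lattice L"
    and f: "\<And>i. i < n \<Longrightarrow> lattice_hom L (M i) (f i)"
    and surj: "\<And>i. i < n \<Longrightarrow> f i ` carrier L = carrier (M i)"
    and M: "\<And>i. i < n \<Longrightarrow> primes_maximal (M i)"
    and inj: "\<And>x y. \<lbrakk>x \<in> carrier L; y \<in> carrier L; \<And>i. i < n \<Longrightarrow> f i x = f i y\<rbrakk> \<Longrightarrow> x = y"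
  shows "primes_maximal L"
  unfolding primes_maximal_def
proof (intro ballI impI)
  fix \<phi> \<psi> assume \<phi>: "\<phi> \<in> Spec L" and \<psi>: "\<psi> \<in> Con L" and sub: "\<phi> \<subseteq> \<psi>"
  have "\<phi> \<in> Con L" using \<phi> by (simp add: Spec_def)
  have "\<exists>i<n. pullback L (f i) (Id_on (carrier (M i))) \<subseteq> \<phi>"
  proof (rule Spec_finite_Inter[OF L \<phi>])
    fix i assume "i < n"
    then have "lattice_hom L (M i) (f i)" by (rule f)
    then show "pullback L (f i) (Id_on (carrier (M i))) \<in> Con L"
      by (rule pullback_in_Con) (use \<open>lattice_hom L (M i) (f i)\<close> in \<open>simp add: Id_on_in_Con lattice_hom_def\<close>)
  next
    show "{p \<in> carrier L \<times> carrier L. \<forall>i<n. p \<in> pullback L (f i) (Id_on (carrier (M i)))} \<subseteq> \<phi>"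
    proof clarify
      fix x y assume xy: "x \<in> carrier L" "y \<in> carrier L"
        and ker: "\<forall>i<n. (x, y) \<in> pullback L (f i) (Id_on (carrier (M i)))"
      have "x = y" using ker by (intro inj xy) (simp add: pullback_def Id_on_iff)
      then show "(x, y) \<in> \<phi>" using xy Con_refl[OF \<open>\<phi> \<in> Con L\<close>] by simp
    qed
  qed
  then obtain i where "i < n" "pullback L (f i) (Id_on (carrier (M i))) \<subseteq> \<phi>" by blast
  then show "\<psi> = \<phi> \<or> \<psi> = carrier L \<times> carrier L"
    using Spec_above_kernel_maximal[OF f surj M \<phi> _ \<psi> sub] by blast
qed

text \<open>Transports the subdirect embedding along an isomorphism from the concrete product or sum
  \<open>P\<close>, which may live on another type. That \<open>P\<close> is a lattice comes from
  the isomorphism, so the morphism property may be proved under that premise.\<close>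

lemma primes_maximal_subdirect_iso:
  fixes L :: "'a gorder" and P :: "'c gorder" and M :: "nat \<Rightarrow> 'b gorder"
  assumes iso: "bl_isomorphic P L"
    and f: "\<And>i. \<lbrakk>i < n; lattice P\<rbrakk> \<Longrightarrow> lattice_hom P (M i) (f i)"
    and surj: "\<And>i. i < n \<Longrightarrow> f i ` carrier P = carrier (M i)"
    and M: "\<And>i. i < n \<Longrightarrow> primes_maximal (M i)"
    and inj: "\<And>x y. \<lbrakk>x \<in> carrier P; y \<in> carrier P; \<And>i. i < n \<Longrightarrow> f i x = f i y\<rbrakk> \<Longrightarrow> x = y"
  shows "primes_maximal L"
proof -
  obtain h where h: "lattice_hom P L h" and bij: "bij_betw h (carrier P) (carrier L)"
    using iso bl_hom_lattice_hom unfolding bl_isomorphic_def by blast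
  let ?g = "inv_into (carrier P) h"
  have g: "lattice_hom L P ?g" by (rule lattice_hom_inverse[OF h bij])
  have bij_g: "bij_betw ?g (carrier L) (carrier P)" by (rule bij_betw_inv_into[OF bij])
  have P: "lattice P" and L: "lattice L" using h by (simp_all add: lattice_hom_def)
  show ?thesis
  proof (rule primes_maximal_subdirect[OF L, of n M "\<lambda>i. f i \<circ> ?g"])
    fix x y assume xy: "x \<in> carrier L" "y \<in> carrier L"
      and eq: "\<And>i. i < n \<Longrightarrow> (f i \<circ> ?g) x = (f i \<circ> ?g) y"
    have "?g x = ?g y"
      using xy bij_betwE[OF bij_g] eq by (intro inj) simp_all
    then show "x = y" using xy bij_g by (meson bij_betw_imp_inj_on inj_onD)
  next
    fix i assume i: "i < n"
    show "lattice_hom L (M i) (f i \<circ> ?g)" by (rule lattice_hom_comp[OF g f[OF i P]])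
    show "(f i \<circ> ?g) ` carrier L = carrier (M i)"
      using surj[OF i] bij_betw_imp_surj_on[OF bij_g] by (metis image_comp)
  qed (rule M)
qed

section \<open>Direct products and ordinal sums\<close>

text \<open>Joins and meets are defined from the order alone, so they first have to be computed
  componentwise. The restricted functions keep the results in the extensional function
  space.\<close>

lemma lattice_product_proj_hom:
  fixes M :: "'i \<Rightarrow> 'a gorder"
  assumes M: "\<And>i. i \<in> I \<Longrightarrow> lattice (M i)" and P: "lattice (lattice_product I M)" and i: "i \<in> I"
  shows "lattice_hom (lattice_product I M) (M i) (\<lambda>x. x i)"
proof -
  define P where "P = lattice_product I M"
  interpret P: gorder_lattice P using P by (simp add: gorder_lattice_def P_def)
  have cP: "x \<in> carrier P \<longleftrightarrow> x \<in> (\<Pi>\<^sub>E i \<in> I. carrier (M i))" for x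
    by (simp add: P_def lattice_product_def)
  have leP: "x \<sqsubseteq>\<^bsub>P\<^esub> y \<longleftrightarrow> (\<forall>i \<in> I. x i \<sqsubseteq>\<^bsub>M i\<^esub> y i)" for x y
    by (simp add: P_def lattice_product_def)
  have c: "x i \<in> carrier (M i)" if "x \<in> carrier P" "i \<in> I" for x i
    using that by (auto simp: cP)
  have join: "x \<squnion>\<^bsub>P\<^esub> y = (\<lambda>i\<in>I. x i \<squnion>\<^bsub>M i\<^esub> y i)"
    if x: "x \<in> carrier P" and y: "y \<in> carrier P" for x y
  proof (rule P.join_eqI[OF x y])
    have M_join: "x i \<squnion>\<^bsub>M i\<^esub> y i \<in> carrier (M i)" "x i \<sqsubseteq>\<^bsub>M i\<^esub> x i \<squnion>\<^bsub>M i\<^esub> y i"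
      "y i \<sqsubseteq>\<^bsub>M i\<^esub> x i \<squnion>\<^bsub>M i\<^esub> y i"
      "\<And>w. \<lbrakk>w \<in> carrier P; x i \<sqsubseteq>\<^bsub>M i\<^esub> w i; y i \<sqsubseteq>\<^bsub>M i\<^esub> w i\<rbrakk> \<Longrightarrow> x i \<squnion>\<^bsub>M i\<^esub> y i \<sqsubseteq>\<^bsub>M i\<^esub> w i"
      if "i \<in> I" for i
    proof -
      interpret lattice "M i" by (rule M[OF that])
      show "x i \<squnion>\<^bsub>M i\<^esub> y i \<in> carrier (M i)" "x i \<sqsubseteq>\<^bsub>M i\<^esub> x i \<squnion>\<^bsub>M i\<^esub> y i"
        "y i \<sqsubseteq>\<^bsub>M i\<^esub> x i \<squnion>\<^bsub>M i\<^esub> y i"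
        "\<And>w. \<lbrakk>w \<in> carrier P; x i \<sqsubseteq>\<^bsub>M i\<^esub> w i; y i \<sqsubseteq>\<^bsub>M i\<^esub> w i\<rbrakk> \<Longrightarrow> x i \<squnion>\<^bsub>M i\<^esub> y i \<sqsubseteq>\<^bsub>M i\<^esub> w i"
        by (simp_all add: c x y that join_left join_right join_le)
    qed
    show "(\<lambda>i\<in>I. x i \<squnion>\<^bsub>M i\<^esub> y i) \<in> carrier P" using M_join(1) by (simp add: cP)
    show "x \<sqsubseteq>\<^bsub>P\<^esub> (\<lambda>i\<in>I. x i \<squnion>\<^bsub>M i\<^esub> y i)" using M_join(2) by (simp add: leP)
    show "y \<sqsubseteq>\<^bsub>P\<^esub> (\<lambda>i\<in>I. x i \<squnion>\<^bsub>M i\<^esub> y i)" using M_join(3) by (simp add: leP)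
    show "(\<lambda>i\<in>I. x i \<squnion>\<^bsub>M i\<^esub> y i) \<sqsubseteq>\<^bsub>P\<^esub> w" if "w \<in> carrier P" "x \<sqsubseteq>\<^bsub>P\<^esub> w" "y \<sqsubseteq>\<^bsub>P\<^esub> w" for w
      using that M_join(4) by (simp add: leP)
  qed
  have meet: "x \<sqinter>\<^bsub>P\<^esub> y = (\<lambda>i\<in>I. x i \<sqinter>\<^bsub>M i\<^esub> y i)"
    if x: "x \<in> carrier P" and y: "y \<in> carrier P" for x y
  proof (rule P.meet_eqI[OF x y])
    have M_meet: "x i \<sqinter>\<^bsub>M i\<^esub> y i \<in> carrier (M i)" "x i \<sqinter>\<^bsub>M i\<^esub> y i \<sqsubseteq>\<^bsub>M i\<^esub> x i"
      "x i \<sqinter>\<^bsub>M i\<^esub> y i \<sqsubseteq>\<^bsub>M i\<^esub> y i"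
      "\<And>w. \<lbrakk>w \<in> carrier P; w i \<sqsubseteq>\<^bsub>M i\<^esub> x i; w i \<sqsubseteq>\<^bsub>M i\<^esub> y i\<rbrakk> \<Longrightarrow> w i \<sqsubseteq>\<^bsub>M i\<^esub> x i \<sqinter>\<^bsub>M i\<^esub> y i"
      if "i \<in> I" for i
    proof -
      interpret lattice "M i" by (rule M[OF that])
      show "x i \<sqinter>\<^bsub>M i\<^esub> y i \<in> carrier (M i)" "x i \<sqinter>\<^bsub>M i\<^esub> y i \<sqsubseteq>\<^bsub>M i\<^esub> x i"
        "x i \<sqinter>\<^bsub>M i\<^esub> y i \<sqsubseteq>\<^bsub>M i\<^esub> y i"
        "\<And>w. \<lbrakk>w \<in> carrier P; w i \<sqsubseteq>\<^bsub>M i\<^esub> x i; w i \<sqsubseteq>\<^bsub>M i\<^esub> y i\<rbrakk> \<Longrightarrow> w i \<sqsubseteq>\<^bsub>M i\<^esub> x i \<sqinter>\<^bsub>M i\<^esub> y i"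
        by (simp_all add: c x y that meet_left meet_right meet_le)
    qed
    show "(\<lambda>i\<in>I. x i \<sqinter>\<^bsub>M i\<^esub> y i) \<in> carrier P" using M_meet(1) by (simp add: cP)
    show "(\<lambda>i\<in>I. x i \<sqinter>\<^bsub>M i\<^esub> y i) \<sqsubseteq>\<^bsub>P\<^esub> x" using M_meet(2) by (simp add: leP)
    show "(\<lambda>i\<in>I. x i \<sqinter>\<^bsub>M i\<^esub> y i) \<sqsubseteq>\<^bsub>P\<^esub> y" using M_meet(3) by (simp add: leP)
    show "w \<sqsubseteq>\<^bsub>P\<^esub> (\<lambda>i\<in>I. x i \<sqinter>\<^bsub>M i\<^esub> y i)" if "w \<in> carrier P" "w \<sqsubseteq>\<^bsub>P\<^esub> x" "w \<sqsubseteq>\<^bsub>P\<^esub> y" for w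
      using that M_meet(4) by (simp add: leP)
  qed
  show ?thesis
    unfolding lattice_hom_def P_def[symmetric]
    using P.lattice_axioms M[OF i] i c by (simp add: join meet Pi_iff)
qed

lemma primes_maximal_product:
  fixes M :: "nat \<Rightarrow> 'a gorder" and L :: "'a gorder"
  assumes iso: "bl_isomorphic (lattice_product {..<n} M) L"
    and bl: "\<And>i. i < n \<Longrightarrow> bounded_lattice (M i)" and M: "\<And>i. i < n \<Longrightarrow> primes_maximal (M i)"
  shows "primes_maximal L"
proof (rule primes_maximal_subdirect_iso[OF iso, of n M "\<lambda>i x. x i"])
  have lat: "lattice (M i)" if "i < n" for i using bl[OF that] by (simp add: bounded_lattice_def)
  fix i assume i: "i < n"
  show "lattice_hom (lattice_product {..<n} M) (M i) (\<lambda>x. x i)"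
    if "lattice (lattice_product {..<n} M)"
    using lat i that by (intro lattice_product_proj_hom) simp_all
  show "(\<lambda>x. x i) ` carrier (lattice_product {..<n} M) = carrier (M i)"
  proof (intro equalityI subsetI)
    fix a assume a: "a \<in> carrier (M i)"
    \<comment> \<open>Surjectivity needs some element in every other factor; the least elements
      serve as padding.\<close>
    let ?x = "\<lambda>j\<in>{..<n}. if j = i then a else \<bottom>\<^bsub>M j\<^esub>"
    have "\<bottom>\<^bsub>M j\<^esub> \<in> carrier (M j)" if "j < n" for j
    proof -
      interpret bounded_lattice "M j" by (rule bl[OF that])
      show ?thesis by simp
    qed
    then have x: "?x \<in> carrier (lattice_product {..<n} M)"
      using a by (simp add: lattice_product_def)
    show "a \<in> (\<lambda>x. x i) ` carrier (lattice_product {..<n} M)"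
      by (rule image_eqI[OF _ x]) (use i in simp)
  qed (use i in \<open>auto simp: lattice_product_def\<close>)
next
  fix x y :: "nat \<Rightarrow> 'a"
  assume "x \<in> carrier (lattice_product {..<n} M)" "y \<in> carrier (lattice_product {..<n} M)"
    and "\<And>i. i < n \<Longrightarrow> x i = y i"
  then show "x = y" by (intro PiE_ext[of x "{..<n}" _ y]) (simp_all add: lattice_product_def)
qed (rule M)

text \<open>The two maps collapse one summand each to the gluing point. Together they separate
  points, which exhibits the ordinal sum as a subdirect product of its summands.\<close>

lemma
  fixes A :: "'a gorder" and B :: "'b gorder"
  assumes A: "bounded_lattice A" and B: "bounded_lattice B" and S: "lattice (ordinal_sum A B)"
  shows ordinal_sum_lower_hom:
      "lattice_hom (ordinal_sum A B) A (case_sum (\<lambda>a. a) (\<lambda>_. \<top>\<^bsub>A\<^esub>))" (is ?lower)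
    and ordinal_sum_upper_hom:
      "lattice_hom (ordinal_sum A B) B (case_sum (\<lambda>_. \<bottom>\<^bsub>B\<^esub>) (\<lambda>b. b))" (is ?upper)
proof -
  define S where "S = ordinal_sum A B"
  interpret S: gorder_lattice S using S by (simp add: gorder_lattice_def S_def)
  interpret A: bounded_lattice A by (rule A)
  interpret B: bounded_lattice B by (rule B)
  interpret A: gorder_lattice A ..
  interpret B: gorder_lattice B ..
  have carrier_S: "Inl a \<in> carrier S \<longleftrightarrow> a \<in> carrier A"
    "Inr b \<in> carrier S \<longleftrightarrow> b \<in> carrier B \<and> b \<noteq> \<bottom>\<^bsub>B\<^esub>" for a b
    by (auto simp: S_def ordinal_sum_def)
  have le_S: "Inl a \<sqsubseteq>\<^bsub>S\<^esub> Inl a' \<longleftrightarrow> a \<sqsubseteq>\<^bsub>A\<^esub> a'" "Inl a \<sqsubseteq>\<^bsub>S\<^esub> Inr b" "\<not> Inr b \<sqsubseteq>\<^bsub>S\<^esub> Inl a"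
    "Inr b \<sqsubseteq>\<^bsub>S\<^esub> Inr b' \<longleftrightarrow> b \<sqsubseteq>\<^bsub>B\<^esub> b'" for a a' b b'
    by (simp_all add: S_def ordinal_sum_def)
  have joins:
    "\<lbrakk>a \<in> carrier A; a' \<in> carrier A\<rbrakk> \<Longrightarrow> Inl a \<squnion>\<^bsub>S\<^esub> Inl a' = Inl (a \<squnion>\<^bsub>A\<^esub> a')"
    "\<lbrakk>a \<in> carrier A; b \<in> carrier B; b \<noteq> \<bottom>\<^bsub>B\<^esub>\<rbrakk> \<Longrightarrow> Inl a \<squnion>\<^bsub>S\<^esub> Inr b = Inr b"
    "\<lbrakk>a \<in> carrier A; b \<in> carrier B; b \<noteq> \<bottom>\<^bsub>B\<^esub>\<rbrakk> \<Longrightarrow> Inr b \<squnion>\<^bsub>S\<^esub> Inl a = Inr b"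
    "\<lbrakk>b \<in> carrier B; b' \<in> carrier B; b \<noteq> \<bottom>\<^bsub>B\<^esub>; b' \<noteq> \<bottom>\<^bsub>B\<^esub>\<rbrakk>
      \<Longrightarrow> Inr b \<squnion>\<^bsub>S\<^esub> Inr b' = Inr (b \<squnion>\<^bsub>B\<^esub> b')" for a a' b b'
  proof -
    show "Inl a \<squnion>\<^bsub>S\<^esub> Inl a' = Inl (a \<squnion>\<^bsub>A\<^esub> a')" if "a \<in> carrier A" "a' \<in> carrier A"
    proof (rule S.join_eqI)
      fix w assume "w \<in> carrier S" "Inl a \<sqsubseteq>\<^bsub>S\<^esub> w" "Inl a' \<sqsubseteq>\<^bsub>S\<^esub> w"
      then show "Inl (a \<squnion>\<^bsub>A\<^esub> a') \<sqsubseteq>\<^bsub>S\<^esub> w"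
        using that by (cases w) (simp_all add: carrier_S le_S A.join_le)
    qed (use that in \<open>simp_all add: carrier_S le_S A.join_left A.join_right\<close>)
    assume b: "b \<in> carrier B" "b \<noteq> \<bottom>\<^bsub>B\<^esub>"
    show "Inl a \<squnion>\<^bsub>S\<^esub> Inr b = Inr b" if "a \<in> carrier A"
      using b that by (intro S.join_absorb2) (simp_all add: carrier_S le_S)
    show "Inr b \<squnion>\<^bsub>S\<^esub> Inl a = Inr b" if "a \<in> carrier A"
      using b that by (intro S.join_absorb1) (simp_all add: carrier_S le_S)
    show "Inr b \<squnion>\<^bsub>S\<^esub> Inr b' = Inr (b \<squnion>\<^bsub>B\<^esub> b')" if b': "b' \<in> carrier B" "b' \<noteq> \<bottom>\<^bsub>B\<^esub>"
    proof (rule S.join_eqI)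
      \<comment> \<open>Only the least element of \<open>B\<close> lacks an \<open>Inr\<close> copy,
        so the join must be shown to differ from it.\<close>
      have "b \<squnion>\<^bsub>B\<^esub> b' \<noteq> \<bottom>\<^bsub>B\<^esub>"
        using B.join_left[OF b(1) b'(1)] B.le_antisym[of b "\<bottom>\<^bsub>B\<^esub>"] b by auto
      then show "Inr (b \<squnion>\<^bsub>B\<^esub> b') \<in> carrier S" using b b' by (simp add: carrier_S)
      fix w assume "w \<in> carrier S" "Inr b \<sqsubseteq>\<^bsub>S\<^esub> w" "Inr b' \<sqsubseteq>\<^bsub>S\<^esub> w"
      then show "Inr (b \<squnion>\<^bsub>B\<^esub> b') \<sqsubseteq>\<^bsub>S\<^esub> w"
        using b b' by (cases w) (simp_all add: carrier_S le_S B.join_le)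
    qed (use b b' in \<open>simp_all add: carrier_S le_S B.join_left B.join_right\<close>)
  qed
  have meets:
    "\<lbrakk>a \<in> carrier A; a' \<in> carrier A\<rbrakk> \<Longrightarrow> Inl a \<sqinter>\<^bsub>S\<^esub> Inl a' = Inl (a \<sqinter>\<^bsub>A\<^esub> a')"
    "\<lbrakk>a \<in> carrier A; b \<in> carrier B; b \<noteq> \<bottom>\<^bsub>B\<^esub>\<rbrakk> \<Longrightarrow> Inl a \<sqinter>\<^bsub>S\<^esub> Inr b = Inl a"
    "\<lbrakk>a \<in> carrier A; b \<in> carrier B; b \<noteq> \<bottom>\<^bsub>B\<^esub>\<rbrakk> \<Longrightarrow> Inr b \<sqinter>\<^bsub>S\<^esub> Inl a = Inl a"
    "\<lbrakk>b \<in> carrier B; b' \<in> carrier B; b \<noteq> \<bottom>\<^bsub>B\<^esub>; b' \<noteq> \<bottom>\<^bsub>B\<^esub>\<rbrakk> \<Longrightarrow> Inr b \<sqinter>\<^bsub>S\<^esub> Inr b' =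
      (if b \<sqinter>\<^bsub>B\<^esub> b' = \<bottom>\<^bsub>B\<^esub> then Inl \<top>\<^bsub>A\<^esub> else Inr (b \<sqinter>\<^bsub>B\<^esub> b'))" for a a' b b'
  proof -
    show "Inl a \<sqinter>\<^bsub>S\<^esub> Inl a' = Inl (a \<sqinter>\<^bsub>A\<^esub> a')" if "a \<in> carrier A" "a' \<in> carrier A"
    proof (rule S.meet_eqI)
      fix w assume "w \<in> carrier S" "w \<sqsubseteq>\<^bsub>S\<^esub> Inl a" "w \<sqsubseteq>\<^bsub>S\<^esub> Inl a'"
      then show "w \<sqsubseteq>\<^bsub>S\<^esub> Inl (a \<sqinter>\<^bsub>A\<^esub> a')"
        using that by (cases w) (simp_all add: carrier_S le_S A.meet_le)
    qed (use that in \<open>simp_all add: carrier_S le_S A.meet_left A.meet_right\<close>)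
    assume b: "b \<in> carrier B" "b \<noteq> \<bottom>\<^bsub>B\<^esub>"
    show "Inl a \<sqinter>\<^bsub>S\<^esub> Inr b = Inl a" if "a \<in> carrier A"
      using b that by (intro S.meet_absorb1) (simp_all add: carrier_S le_S)
    show "Inr b \<sqinter>\<^bsub>S\<^esub> Inl a = Inl a" if "a \<in> carrier A"
      using b that by (intro S.meet_absorb2) (simp_all add: carrier_S le_S)
    \<comment> \<open>Two elements of the upper part may meet in the least element of
      \<open>B\<close>, which is represented by the top of \<open>A\<close>; hence the case
      distinction.\<close>
    show "Inr b \<sqinter>\<^bsub>S\<^esub> Inr b' = (if b \<sqinter>\<^bsub>B\<^esub> b' = \<bottom>\<^bsub>B\<^esub> then Inl \<top>\<^bsub>A\<^esub> else Inr (b \<sqinter>\<^bsub>B\<^esub> b'))"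
      if b': "b' \<in> carrier B" "b' \<noteq> \<bottom>\<^bsub>B\<^esub>"
    proof (rule S.meet_eqI)
      fix w assume w: "w \<in> carrier S" "w \<sqsubseteq>\<^bsub>S\<^esub> Inr b" "w \<sqsubseteq>\<^bsub>S\<^esub> Inr b'"
      show "w \<sqsubseteq>\<^bsub>S\<^esub> (if b \<sqinter>\<^bsub>B\<^esub> b' = \<bottom>\<^bsub>B\<^esub> then Inl \<top>\<^bsub>A\<^esub> else Inr (b \<sqinter>\<^bsub>B\<^esub> b'))"
      proof (cases w)
        case (Inr d)
        then have d: "d \<in> carrier B" "d \<noteq> \<bottom>\<^bsub>B\<^esub>" "d \<sqsubseteq>\<^bsub>B\<^esub> b \<sqinter>\<^bsub>B\<^esub> b'"
          using w b b' by (simp_all add: carrier_S le_S B.meet_le)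
        then have "b \<sqinter>\<^bsub>B\<^esub> b' \<noteq> \<bottom>\<^bsub>B\<^esub>" using B.le_antisym[of d "\<bottom>\<^bsub>B\<^esub>"] by auto
        then show ?thesis using d Inr by (simp add: le_S)
      qed (use w in \<open>simp add: carrier_S le_S\<close>)
    qed (use b b' in \<open>simp_all add: carrier_S le_S B.meet_left B.meet_right\<close>)
  qed
  note lattices = S.lattice_axioms A.lattice_axioms B.lattice_axioms
  have "lattice_hom S A (case_sum (\<lambda>a. a) (\<lambda>_. \<top>\<^bsub>A\<^esub>))"
    unfolding lattice_hom_def
  proof (intro conjI ballI lattices funcsetI)
    fix x y assume xy: "x \<in> carrier S" "y \<in> carrier S"
    show "case_sum (\<lambda>a. a) (\<lambda>_. \<top>\<^bsub>A\<^esub>) (x \<squnion>\<^bsub>S\<^esub> y) =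
        case_sum (\<lambda>a. a) (\<lambda>_. \<top>\<^bsub>A\<^esub>) x \<squnion>\<^bsub>A\<^esub> case_sum (\<lambda>a. a) (\<lambda>_. \<top>\<^bsub>A\<^esub>) y"
      using xy by (cases x; cases y)
        (simp_all add: carrier_S joins A.join_absorb1 A.join_absorb2)
    show "case_sum (\<lambda>a. a) (\<lambda>_. \<top>\<^bsub>A\<^esub>) (x \<sqinter>\<^bsub>S\<^esub> y) =
        case_sum (\<lambda>a. a) (\<lambda>_. \<top>\<^bsub>A\<^esub>) x \<sqinter>\<^bsub>A\<^esub> case_sum (\<lambda>a. a) (\<lambda>_. \<top>\<^bsub>A\<^esub>) y"
      using xy by (cases x; cases y)
        (simp_all add: carrier_S meets A.meet_absorb1 A.meet_absorb2)
  next
    fix x assume "x \<in> carrier S"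
    then show "case_sum (\<lambda>a. a) (\<lambda>_. \<top>\<^bsub>A\<^esub>) x \<in> carrier A" by (cases x) (simp_all add: carrier_S)
  qed
  then show ?lower by (simp add: S_def)
  have "lattice_hom S B (case_sum (\<lambda>_. \<bottom>\<^bsub>B\<^esub>) (\<lambda>b. b))"
    unfolding lattice_hom_def
  proof (intro conjI ballI lattices funcsetI)
    fix x y assume xy: "x \<in> carrier S" "y \<in> carrier S"
    show "case_sum (\<lambda>_. \<bottom>\<^bsub>B\<^esub>) (\<lambda>b. b) (x \<squnion>\<^bsub>S\<^esub> y) =
        case_sum (\<lambda>_. \<bottom>\<^bsub>B\<^esub>) (\<lambda>b. b) x \<squnion>\<^bsub>B\<^esub> case_sum (\<lambda>_. \<bottom>\<^bsub>B\<^esub>) (\<lambda>b. b) y"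
      using xy by (cases x; cases y)
        (simp_all add: carrier_S joins B.join_absorb1 B.join_absorb2)
    show "case_sum (\<lambda>_. \<bottom>\<^bsub>B\<^esub>) (\<lambda>b. b) (x \<sqinter>\<^bsub>S\<^esub> y) =
        case_sum (\<lambda>_. \<bottom>\<^bsub>B\<^esub>) (\<lambda>b. b) x \<sqinter>\<^bsub>B\<^esub> case_sum (\<lambda>_. \<bottom>\<^bsub>B\<^esub>) (\<lambda>b. b) y"
      using xy by (cases x; cases y)
        (simp_all add: carrier_S meets B.meet_absorb1 B.meet_absorb2)
  next
    fix x assume "x \<in> carrier S"
    then show "case_sum (\<lambda>_. \<bottom>\<^bsub>B\<^esub>) (\<lambda>b. b) x \<in> carrier B" by (cases x) (simp_all add: carrier_S)
  qed
  then show ?upper by (simp add: S_def)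
qed

lemma primes_maximal_ordinal_sum:
  fixes A B L :: "'a gorder"
  assumes iso: "bl_isomorphic (ordinal_sum A B) L"
    and bl: "bounded_lattice A" "bounded_lattice B"
    and pm: "primes_maximal A" "primes_maximal B"
  shows "primes_maximal L"
proof -
  interpret A: bounded_lattice A by (rule bl)
  interpret B: bounded_lattice B by (rule bl)
  let ?M = "\<lambda>i::nat. if i = 0 then A else B"
  let ?f = "\<lambda>i::nat. if i = 0 then case_sum (\<lambda>a. a) (\<lambda>_. \<top>\<^bsub>A\<^esub>) else case_sum (\<lambda>_. \<bottom>\<^bsub>B\<^esub>) (\<lambda>b. b)"
  show ?thesis
  proof (rule primes_maximal_subdirect_iso[OF iso, of 2 ?M ?f])
    fix i :: nat
    show "lattice_hom (ordinal_sum A B) (?M i) (?f i)" if "lattice (ordinal_sum A B)"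
      using ordinal_sum_lower_hom[OF bl that] ordinal_sum_upper_hom[OF bl that] by simp
    have "case_sum (\<lambda>a. a) (\<lambda>_. \<top>\<^bsub>A\<^esub>) ` carrier (ordinal_sum A B) = carrier A"
      by (auto simp: ordinal_sum_def image_Un image_image)
    \<comment> \<open>The least element of \<open>B\<close> has no \<open>Inr\<close> preimage; it
      is the value at the elements of \<open>A\<close>, and the top of \<open>A\<close> shows that
      there is one.\<close>
    moreover have "case_sum (\<lambda>_. \<bottom>\<^bsub>B\<^esub>) (\<lambda>b. b) ` carrier (ordinal_sum A B) = carrier B"
      using A.top_closed by (auto simp: ordinal_sum_def image_Un image_image)
    ultimately show "?f i ` carrier (ordinal_sum A B) = carrier (?M i)" by simp
  next
    fix x y assume "x \<in> carrier (ordinal_sum A B)" "y \<in> carrier (ordinal_sum A B)"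
      and eq: "\<And>i. i < 2 \<Longrightarrow> ?f i x = ?f i y"
    then show "x = y"
      using eq[of 0] eq[of 1] by (cases x; cases y) (auto simp: ordinal_sum_def)
  qed (use pm in simp)
qed

section \<open>Constructible lattices, admissibility and Going Up\<close>

lemma constructible_bounded_lattice: "constructible L \<Longrightarrow> bounded_lattice L"
  by (erule constructible.cases) simp_all

lemma constructible_primes_maximal: "constructible L \<Longrightarrow> primes_maximal L"
proof (induction rule: constructible.induct)
  case (product n M L)
  then show ?case
    by (intro primes_maximal_product[of n M L] constructible_bounded_lattice) simp_all
next
  case (ordinal_sum A B L)
  then show ?case
    by (intro primes_maximal_ordinal_sum[of A B L] constructible_bounded_lattice)
qed (simp_all add: primes_maximal_distributive primes_maximal_finite_modular
      primes_maximal_relatively_complemented)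

text \<open>The two-class condition is imposed only on the image of \<open>f\<close>. This covers a
  distributive codomain, where all elements satisfy it, as well as an image consisting of the two
  bounds. Preservation of the bounds keeps the pullback proper.\<close>

lemma pullback_two_classes_Spec:
  assumes A: "bounded_lattice A" and B: "bounded_lattice B" and f: "f \<in> bl_hom A B"
    and \<psi>: "\<psi> \<in> Con B" and proper: "\<psi> \<noteq> carrier B \<times> carrier B"
    and two: "\<And>x. x \<in> carrier A \<Longrightarrow> (\<bottom>\<^bsub>B\<^esub>, f x) \<in> \<psi> \<or> (f x, \<top>\<^bsub>B\<^esub>) \<in> \<psi>"
  shows "pullback A f \<psi> \<in> Spec A"
proof (rule two_classes_Spec[OF A])
  interpret A: bounded_lattice A by (rule A)
  have bounds: "f \<bottom>\<^bsub>A\<^esub> = \<bottom>\<^bsub>B\<^esub>" "f \<top>\<^bsub>A\<^esub> = \<top>\<^bsub>B\<^esub>" using f by (simp_all add: bl_hom_def)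
  show "pullback A f \<psi> \<in> Con A" by (rule pullback_in_Con[OF bl_hom_lattice_hom[OF f] \<psi>])
  have "(\<bottom>\<^bsub>B\<^esub>, \<top>\<^bsub>B\<^esub>) \<notin> \<psi>" using proper Con_eq_full[OF B \<psi>] by blast
  then have "(\<bottom>\<^bsub>A\<^esub>, \<top>\<^bsub>A\<^esub>) \<notin> pullback A f \<psi>" by (simp add: pullback_def bounds)
  then show "pullback A f \<psi> \<noteq> carrier A \<times> carrier A" by auto
  show "(\<bottom>\<^bsub>A\<^esub>, x) \<in> pullback A f \<psi> \<or> (x, \<top>\<^bsub>A\<^esub>) \<in> pullback A f \<psi>" if "x \<in> carrier A" for x
    using two[OF that] that by (simp add: pullback_def bounds)
qed

theorem proposition5p4:
  fixes L :: "'a gorder" and L' :: "'b gorder" and m :: "'a \<Rightarrow> 'b"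
  assumes "bounded_lattice L'"
    and "bounded_lattice L"
    and "constructible L"
    and "m \<in> bl_hom L L'"
  shows "(admissible L L' m \<longrightarrow> going_up L L' m) \<and>
         (distributive_lattice L' \<longrightarrow> admissible L L' m \<and> going_up L L' m) \<and>
         (m ` carrier L = {\<bottom>\<^bsub>L'\<^esub>, \<top>\<^bsub>L'\<^esub>} \<longrightarrow> admissible L L' m \<and> going_up L L' m)"
proof -
  have "\<psi> = \<phi>" if "\<phi> \<in> Spec L" "\<psi> \<in> Spec L" "\<phi> \<subseteq> \<psi>" for \<phi> \<psi>
  proof -
    have "\<psi> \<in> Con L" "\<psi> \<noteq> carrier L \<times> carrier L" using that(2) by (simp_all add: Spec_def)
    then show ?thesis
      using constructible_primes_maximal[OF assms(3)] that unfolding primes_maximal_def by metis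
  qed
  \<comment> \<open>Comparable primes of \<open>L\<close> are equal, so
    \<open>\<phi>\<^sub>1\<close> itself serves as the required
    \<open>\<psi>\<^sub>1\<close>.\<close>
  then have going_up: "going_up L L' m"
    unfolding going_up_def by blast
  have m: "m x \<in> carrier L'" if "x \<in> carrier L" for x
    using assms(4) that by (auto simp: bl_hom_def)
  have "pullback L m \<psi> \<in> Spec L" if "distributive_lattice L'" "\<psi> \<in> Spec L'" for \<psi>
    using that(2) Spec_distributive_two_classes[OF assms(1) that m]
    by (intro pullback_two_classes_Spec[OF assms(2,1,4)]) (simp_all add: Spec_def)
  moreover have "pullback L m \<psi> \<in> Spec L"
    if img: "m ` carrier L = {\<bottom>\<^bsub>L'\<^esub>, \<top>\<^bsub>L'\<^esub>}" and \<psi>: "\<psi> \<in> Spec L'" for \<psi>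
  proof (rule pullback_two_classes_Spec[OF assms(2,1,4)])
    show con: "\<psi> \<in> Con L'" and "\<psi> \<noteq> carrier L' \<times> carrier L'" using \<psi> by (simp_all add: Spec_def)
    fix x assume x: "x \<in> carrier L"
    then have "m x = \<bottom>\<^bsub>L'\<^esub> \<or> m x = \<top>\<^bsub>L'\<^esub>" using img by blast
    then show "(\<bottom>\<^bsub>L'\<^esub>, m x) \<in> \<psi> \<or> (m x, \<top>\<^bsub>L'\<^esub>) \<in> \<psi>"
      using Con_refl[OF con m[OF x]] by auto
  qed
  ultimately show ?thesis
    using going_up unfolding admissible_def by blast
qed

end
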